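(* Let $X\subset\mathbb{R}^d$ be the attractor of an iterated function system $(T_1,\ldots,T_m)$ satisfying the strong separation condition. Consider the dynamics $f\colon X\to X$ defined by the inverses of the maps $T_i$. Then there is an uncountable collection $\mathcal{N}$ of Borel measurable subsets of $X$ satisfying: (1) there is a continuous function $\varphi\colon X\to\mathbb{R}$ such that every $N\in\mathcal{N}$ is contained in $\hat{X}(\varphi)$; (2) every $N\in\mathcal{N}$ is dense in $X$ and satisfies $f(N)\subset N$; (3) for every distinct $N,N'\in\mathcal{N}$ we have $N\cap N'=\emptyset$; (4) for every $N\in\mathcal{N}$ we have $h(f|N)=h_{top}(f)$.
   Context: Iterated function system: $T_1,\ldots,T_m\colon\mathbb{R}^d\to\mathbb{R}^d$ are injective contractions; its attractor is the unique nonempty compact set $X$ with $X=\bigcup_{i=1}^m T_i(X)$. Strong separation condition: the sets $T_1(X),\ldots,T_m(X)$ are pairwise disjoint. The map $f\colon X\to X$ is defined by $f(x)=T_i^{-1}(x)$ for $x\in T_i(X)$. Irregular set: for continuous $\varphi\colon X\to\mathbb{R}$, $\hat{X}(\varphi)$ is the set of $x\in X$ for which $\lim_{n\to\infty}\frac1n\sum_{j=0}^{n-1}\varphi(f^j(x))$ does not exist. Topological entropy of a (not necessarily compact or invariant) subset: let $f\colon X\to X$ be a continuous map of a compact metric space and $Z\subset X$. For an open cover $\mathcal{U}$ of $X$, a string $\mathbf{U}=U_{0}\cdots U_{l-1}$ of elements of $\mathcal{U}$ has length $m(\mathbf{U})=l$, and $X(\mathbf{U})=\{x\in X: f^j(x)\in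 U_j,\ 0\le j\le l-1\}$. For $\alpha\in\mathbb{R}$ put $m_{\mathcal{U}}(Z,\alpha)=\lim_{n\to\infty}\inf\{\sum_{\mathbf{U}\in\mathcal{G}}e^{-\alpha m(\mathbf{U})}\}$, the infimum over finite or countable collections $\mathcal{G}$ of strings with $m(\mathbf{U})\ge n$ for all $\mathbf{U}\in\mathcal{G}$ and $Z\subset\bigcup_{\mathbf{U}\in\mathcal{G}}X(\mathbf{U})$. Let $h_{\mathcal{U}}(f|Z)=\inf\{\alpha: m_{\mathcal{U}}(Z,\alpha)=0\}$ and $h(f|Z)=\lim_{\operatorname{diam}(\mathcal{U})\to0}h_{\mathcal{U}}(f|Z)$ (this limit exists), where $\operatorname{diam}(\mathcal{U})=\sup\{\operatorname{diam}(U):U\in\mathcal{U}\}$. $h_{top}(f)$ denotes the usual topological entropy, which equals $h(f|X)$.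
   Formalization: The iterated function system is assumed to have at least two maps (m ≥ 2); for m = 1 the attractor is a single point, every irregular set is empty, and the claim is false. *)

theory Defs
  imports "HOL-Analysis.Analysis"
begin

section \<open>Iterated function systems\<close>

definition iterated_function_system ::
    "nat \<Rightarrow> (nat \<Rightarrow> real ^ 'd \<Rightarrow> real ^ 'd) \<Rightarrow> bool" where
  "iterated_function_system m T \<longleftrightarrow>
     (\<forall>i\<in>{1..m}. inj (T i) \<and> (\<exists>c<1. c-lipschitz_on UNIV (T i)))"

text \<open>For an iterated function system with at least one map, exactly one set satisfies this predicate.\<close>

definition is_attractor ::
    "nat \<Rightarrow> (nat \<Rightarrow> real ^ 'd \<Rightarrow> real ^ 'd) \<Rightarrow> (real ^ 'd) set \<Rightarrow> bool" where
  "is_attractor m T X \<longleftrightarrow> compact X \<and> X \<noteq> {} \<and> X = (\<Union>i\<in>{1..m}. T i ` X)"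

definition strong_separation ::
    "nat \<Rightarrow> (nat \<Rightarrow> real ^ 'd \<Rightarrow> real ^ 'd) \<Rightarrow> (real ^ 'd) set \<Rightarrow> bool" where
  "strong_separation m T X \<longleftrightarrow> disjoint_family_on (\<lambda>i. T i ` X) {1..m}"

text \<open>Meaningful for \<open>x \<in> X\<close> under strong separation, where the index is unique;
  the values outside \<open>X\<close> are irrelevant.\<close>

definition ifs_map ::
    "nat \<Rightarrow> (nat \<Rightarrow> real ^ 'd \<Rightarrow> real ^ 'd) \<Rightarrow> (real ^ 'd) set \<Rightarrow> real ^ 'd \<Rightarrow> real ^ 'd" where
  "ifs_map m T X x = inv (T (THE i. i \<in> {1..m} \<and> x \<in> T i ` X)) x"


section \<open>Irregular sets\<close>

definition irregular_set :: "'a set \<Rightarrow> ('a \<Rightarrow> 'a) \<Rightarrow> ('a \<Rightarrow> real) \<Rightarrow> 'a set" where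
  "irregular_set X f \<phi> =
     {x \<in> X. \<not> convergent (\<lambda>n. (\<Sum>j<n. \<phi> ((f ^^ j) x)) / real n)}"


section \<open>Entropy of subsets\<close>

text \<open>In this section and the next, \<open>f\<close> is meant to be a continuous self-map of a
  nonempty compact set \<open>X\<close>, viewed as a metric space with the induced metric.\<close>

definition open_cover :: "'a::metric_space set \<Rightarrow> 'a set set \<Rightarrow> bool" where
  "open_cover X \<U> \<longleftrightarrow> (\<forall>U\<in>\<U>. openin (top_of_set X) U) \<and> \<Union>\<U> = X"

definition cover_diam :: "'a::metric_space set set \<Rightarrow> real" where
  "cover_diam \<U> = (SUP U\<in>\<U>. diameter U)"

definition string_set :: "'a set \<Rightarrow> ('a \<Rightarrow> 'a) \<Rightarrow> 'a set list \<Rightarrow> 'a set" where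
  "string_set X f s = {x \<in> X. \<forall>j<length s. (f ^^ j) x \<in> s ! j}"

definition string_covers ::
    "'a set \<Rightarrow> ('a \<Rightarrow> 'a) \<Rightarrow> 'a set set \<Rightarrow> 'a set \<Rightarrow> nat \<Rightarrow> 'a set list set set" where
  "string_covers X f \<U> Z n =
     {G. countable G \<and> G \<subseteq> lists \<U> \<and> (\<forall>s\<in>G. n \<le> length s)
         \<and> Z \<subseteq> (\<Union>s\<in>G. string_set X f s)}"

definition cover_measure ::
    "'a set \<Rightarrow> ('a \<Rightarrow> 'a) \<Rightarrow> 'a set set \<Rightarrow> 'a set \<Rightarrow> real \<Rightarrow> ennreal" where
  "cover_measure X f \<U> Z \<alpha> =
     lim (\<lambda>n. INF G\<in>string_covers X f \<U> Z n.
                 (\<Sum>\<^sub>\<infinity>s\<in>G. ennreal (exp (- \<alpha> * real (length s)))))"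

definition cover_entropy ::
    "'a set \<Rightarrow> ('a \<Rightarrow> 'a) \<Rightarrow> 'a set set \<Rightarrow> 'a set \<Rightarrow> ereal" where
  "cover_entropy X f \<U> Z = Inf {ereal \<alpha> | \<alpha>. cover_measure X f \<U> Z \<alpha> = 0}"

text \<open>The limit over all open covers of \<open>X\<close> as their diameter tends to \<open>0\<close>; covers of
  diameter exactly \<open>0\<close> (which exist only for finite \<open>X\<close>) are not excluded.\<close>

definition subset_entropy ::
    "'a::metric_space set \<Rightarrow> ('a \<Rightarrow> 'a) \<Rightarrow> 'a set \<Rightarrow> ereal" where
  "subset_entropy X f Z =
     Lim (inf (filtercomap cover_diam (nhds 0)) (principal {\<U>. open_cover X \<U>}))
       (\<lambda>\<U>. cover_entropy X f \<U> Z)"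


section \<open>Topological entropy\<close>

text \<open>The usual topological entropy, defined through separated sets following Bowen and
  Dinaburg.\<close>

definition separated_set ::
    "'a::metric_space set \<Rightarrow> ('a \<Rightarrow> 'a) \<Rightarrow> nat \<Rightarrow> real \<Rightarrow> 'a set \<Rightarrow> bool" where
  "separated_set X f n \<epsilon> E \<longleftrightarrow>
     finite E \<and> E \<subseteq> X \<and>
     (\<forall>x\<in>E. \<forall>y\<in>E. x \<noteq> y \<longrightarrow> (\<exists>j<n. dist ((f ^^ j) x) ((f ^^ j) y) > \<epsilon>))"

text \<open>By compactness and continuity these cardinalities are bounded for \<open>\<epsilon> > 0\<close>, so the
  supremum in \<^typ>\<open>nat\<close> is a maximum.\<close>

definition max_separated ::
    "'a::metric_space set \<Rightarrow> ('a \<Rightarrow> 'a) \<Rightarrow> nat \<Rightarrow> real \<Rightarrow> nat" where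
  "max_separated X f n \<epsilon> = Sup {card E | E. separated_set X f n \<epsilon> E}"

definition topological_entropy :: "'a::metric_space set \<Rightarrow> ('a \<Rightarrow> 'a) \<Rightarrow> ereal" where
  "topological_entropy X f =
     Lim (at_right 0) (\<lambda>\<epsilon>. limsup (\<lambda>n. ereal (ln (real (max_separated X f n \<epsilon>)) / real n)))"

end

theory Submission
  imports Defs "HOL-Probability.Infinite_Product_Measure"
begin

text \<open>
  Coding points by itineraries identifies \<open>f\<close> with the full shift on \<open>m\<close> symbols, so the topological
  entropy is \<open>ln m\<close>. Let \<open>\<phi>\<close> be the indicator of \<open>T 1 ` X\<close> and let \<open>osc x\<close> be the limsup minus the
  liminf of its Birkhoff averages along the orbit of \<open>x\<close>. For \<open>1/4 < t < 1/2\<close> take the set of all \<open>x\<close>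
  with \<open>osc x = t / 2 ^ k\<close> for some \<open>k\<close>. These sets are Borel, fully invariant (hence dense) and
  consist of irregular points, and they are disjoint because the interval of parameters contains no
  two numbers with ratio a nontrivial power of \<open>2\<close>.

  Admitting every scale \<open>2 ^ k\<close> is what makes the entropy full: put \<open>K = 2 ^ k - 1\<close> and concatenate
  freely words of length \<open>K\<close> that all contain the same number of ones (by the pigeonhole principle some
  count is shared by at least \<open>m ^ K / (K + 1)\<close> words), inserting after each word one marker symbol.
  The markers follow a fixed 0-1 sequence whose averages oscillate by \<open>t\<close>, so \<open>osc x = t / 2 ^ k\<close>. The uniform
  product measure on the free words gives entropy at least \<open>(K ln m - ln (K + 1)) / (K + 1)\<close>.
\<close>

section \<open>Symbolic coding of the attractor\<close>

locale separated_ifs =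
  fixes m :: nat and T :: "nat \<Rightarrow> real ^ 'd \<Rightarrow> real ^ 'd" and X :: "(real ^ 'd) set"
  assumes two_le_m: "2 \<le> m"
    and ifs: "iterated_function_system m T"
    and attractor: "is_attractor m T X"
    and separated: "strong_separation m T X"
begin

section \<open>The inverse dynamics, first symbols and itineraries\<close>

definition f :: "real ^ 'd \<Rightarrow> real ^ 'd" where
  "f = ifs_map m T X"

definition symb :: "real ^ 'd \<Rightarrow> nat" where
  "symb x = (THE i. i \<in> {1..m} \<and> x \<in> T i ` X)"

definition itin :: "real ^ 'd \<Rightarrow> nat \<Rightarrow> nat" where
  "itin x j = symb ((f ^^ j) x)"

lemma compact_X: "compact X" and X_nonempty: "X \<noteq> {}" and X_eq: "X = (\<Union>i\<in>{1..m}. T i ` X)"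
  using attractor by (auto simp: is_attractor_def)

lemma T_in_X: "i \<in> {1..m} \<Longrightarrow> x \<in> X \<Longrightarrow> T i x \<in> X"
  using X_eq by blast

lemma inj_T: "i \<in> {1..m} \<Longrightarrow> inj (T i)"
  using ifs by (auto simp: iterated_function_system_def)

lemma symbI:
  assumes "i \<in> {1..m}" "x \<in> T i ` X"
  shows "symb x = i"
  unfolding symb_def
proof (rule the_equality)
  fix k assume "k \<in> {1..m} \<and> x \<in> T k ` X"
  then show "k = i"
    using assms separated unfolding strong_separation_def disjoint_family_on_def by blast
qed (use assms in auto)

lemma symb_T: "i \<in> {1..m} \<Longrightarrow> x \<in> X \<Longrightarrow> symb (T i x) = i"
  by (auto intro: symbI)

lemma
  assumes "x \<in> X"
  shows symb_in: "symb x \<in> {1..m}" and in_T_symb: "x \<in> T (symb x) ` X"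
proof -
  obtain i where i: "i \<in> {1..m}" "x \<in> T i ` X" using assms X_eq by blast
  then show "symb x \<in> {1..m}" "x \<in> T (symb x) ` X" using symbI[OF i] by auto
qed

lemma f_eq_inv: "f x = inv (T (symb x)) x"
  by (simp add: f_def ifs_map_def symb_def)

lemma f_T: "i \<in> {1..m} \<Longrightarrow> x \<in> X \<Longrightarrow> f (T i x) = x"
  by (simp add: f_eq_inv symb_T inj_T inv_f_f)

lemma
  assumes "x \<in> X"
  shows f_in_X: "f x \<in> X" and T_symb_f: "T (symb x) (f x) = x"
proof -
  obtain y where "y \<in> X" "x = T (symb x) y" using in_T_symb[OF assms] by blast
  moreover have "f (T (symb x) y) = y" using f_T[OF symb_in[OF assms] \<open>y \<in> X\<close>] .
  ultimately show "f x \<in> X" "T (symb x) (f x) = x" by metis+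
qed

lemma funpow_f_in_X: "x \<in> X \<Longrightarrow> (f ^^ n) x \<in> X"
  by (induction n) (auto simp: f_in_X)

lemma itin_in: "x \<in> X \<Longrightarrow> itin x j \<in> {1..m}"
  unfolding itin_def by (intro symb_in funpow_f_in_X)

lemma itin_0: "itin x 0 = symb x"
  by (simp add: itin_def)

lemma itin_funpow: "itin ((f ^^ n) x) j = itin x (n + j)"
  by (simp add: itin_def funpow_add add.commute[of n])

lemma itin_f: "itin (f x) j = itin x (Suc j)"
  using itin_funpow[of 1] by simp

lemma itin_T: "i \<in> {1..m} \<Longrightarrow> x \<in> X \<Longrightarrow> itin (T i x) j = (case j of 0 \<Rightarrow> i | Suc n \<Rightarrow> itin x n)"
  by (cases j) (auto simp: itin_0 symb_T itin_f[symmetric] f_T)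

section \<open>Itineraries and distances\<close>

lemma contraction_factor:
  obtains c where "0 < c" "c < 1"
    "\<And>i x y. i \<in> {1..m} \<Longrightarrow> dist (T i x) (T i y) \<le> c * dist x y"
proof -
  obtain C where C: "\<And>i. i \<in> {1..m} \<Longrightarrow> C i < 1 \<and> (C i)-lipschitz_on UNIV (T i)"
    using ifs unfolding iterated_function_system_def by metis
  \<comment> \<open>The added entry \<open>1/2\<close> makes the common factor positive, so that
    inequalities may be multiplied by it.\<close>
  define c where "c = Max (insert (1/2) (C ` {1..m}))"
  have c: "1/2 \<le> c" "\<And>i. i \<in> {1..m} \<Longrightarrow> C i \<le> c"
    unfolding c_def by (intro Max_ge; simp)+
  have "c < 1" using C by (auto simp: c_def)
  show ?thesis
  proof
    fix i x y assume i: "i \<in> {1..m}"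
    have "dist (T i x) (T i y) \<le> C i * dist x y"
      using C[OF i] by (auto intro: lipschitz_onD)
    also have "\<dots> \<le> c * dist x y" using c i by (intro mult_right_mono) auto
    finally show "dist (T i x) (T i y) \<le> c * dist x y" .
  qed (use c \<open>c < 1\<close> in auto)
qed

lemma continuous_on_T: "i \<in> {1..m} \<Longrightarrow> continuous_on S (T i)"
  using ifs unfolding iterated_function_system_def
  by (meson continuous_on_subset lipschitz_on_continuous_on subset_UNIV)

lemma compact_T: "i \<in> {1..m} \<Longrightarrow> compact S \<Longrightarrow> compact (T i ` S)"
  by (intro compact_continuous_image continuous_on_T)

lemma diameter_bound: "x \<in> X \<Longrightarrow> y \<in> X \<Longrightarrow> dist x y \<le> diameter X"
  using compact_X by (simp add: compact_imp_bounded diameter_bounded_bound)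

text \<open>Two points with the same first symbol are images under one map \<open>T i\<close> of
  their successors under \<open>f\<close>, so every further common symbol contributes a factor
  \<open>c\<close>.\<close>

lemma dist_le_if_itin_eq:
  assumes c: "0 < c" "\<And>i x y. i \<in> {1..m} \<Longrightarrow> dist (T i x) (T i y) \<le> c * dist x y"
  shows "x \<in> X \<Longrightarrow> y \<in> X \<Longrightarrow> (\<And>j. j < n \<Longrightarrow> itin x j = itin y j) \<Longrightarrow>
    dist x y \<le> c ^ n * diameter X"
proof (induction n arbitrary: x y)
  case (Suc n)
  have "symb x = symb y" using Suc.prems(3)[of 0] by (simp add: itin_0)
  then have "dist x y = dist (T (symb x) (f x)) (T (symb x) (f y))"
    using T_symb_f Suc.prems(1,2) by metis
  also have "\<dots> \<le> c * dist (f x) (f y)" using c symb_in Suc.prems by auto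
  also have "\<dots> \<le> c * (c ^ n * diameter X)"
    using Suc.prems c by (intro mult_left_mono Suc.IH) (auto simp: f_in_X itin_f)
  finally show ?case by (simp add: mult_ac)
qed (auto simp: diameter_bound)

text \<open>Cylinders shrink uniformly: one word length \<open>k\<close> serves all pairs of points.
  Density and both upper entropy bounds rest on this.\<close>

lemma itin_determines_nearby:
  assumes "0 < e"
  obtains k where "\<And>x y. x \<in> X \<Longrightarrow> y \<in> X \<Longrightarrow> (\<And>j. j < k \<Longrightarrow> itin x j = itin y j) \<Longrightarrow> dist x y < e"
proof -
  obtain c where c: "0 < c" "c < 1"
    "\<And>i x y. i \<in> {1..m} \<Longrightarrow> dist (T i x) (T i y) \<le> c * dist x y"
    using contraction_factor by blast
  have "(\<lambda>n. c ^ n * diameter X) \<longlonglongrightarrow> 0 * diameter X"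
    using c by (intro tendsto_mult tendsto_const LIMSEQ_realpow_zero) auto
  then have "eventually (\<lambda>n. c ^ n * diameter X < e) sequentially"
    using assms by (intro order_tendstoD(2)[of _ 0]) auto
  then obtain k where "c ^ k * diameter X < e" by (auto simp: eventually_sequentially)
  then show ?thesis
    using dist_le_if_itin_eq[OF c(1,3)] by (intro that[of k]) (meson le_less_trans)
qed

lemma symb_eq_if_close:
  obtains \<delta> where "0 < \<delta>" "\<And>x y. x \<in> X \<Longrightarrow> y \<in> X \<Longrightarrow> dist x y < \<delta> \<Longrightarrow> symb x = symb y"
proof -
  have "\<exists>d>0. \<forall>x\<in>T i ` X. \<forall>y\<in>T k ` X. d \<le> dist x y"
    if "i \<in> {1..m}" "k \<in> {1..m}" "i \<noteq> k" for i k
    using that separated compact_X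
    by (intro separate_compact_closed compact_T compact_imp_closed)
       (auto simp: strong_separation_def disjoint_family_on_def)
  then obtain d where d: "\<And>i k. i \<in> {1..m} \<Longrightarrow> k \<in> {1..m} \<Longrightarrow> i \<noteq> k \<Longrightarrow>
      0 < d i k \<and> (\<forall>x\<in>T i ` X. \<forall>y\<in>T k ` X. d i k \<le> dist x y)"
    by metis
  define P where "P = {p \<in> {1..m} \<times> {1..m}. fst p \<noteq> snd p}"
  \<comment> \<open>The entry \<open>1\<close> makes the minimum meaningful without a discussion of
    whether \<open>P\<close> is empty.\<close>
  define \<delta> where "\<delta> = Min (insert 1 ((\<lambda>p. d (fst p) (snd p)) ` P))"
  have fin: "finite P" by (simp add: P_def)
  show ?thesis
  proof
    show "0 < \<delta>" using d fin unfolding \<delta>_def by (auto simp: P_def)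
    fix x y assume xy: "x \<in> X" "y \<in> X" "dist x y < \<delta>"
    show "symb x = symb y"
    proof (rule ccontr)
      assume ne: "symb x \<noteq> symb y"
      then have "(symb x, symb y) \<in> P" using xy symb_in by (auto simp: P_def simp del: atLeastAtMost_iff)
      then have "\<delta> \<le> d (symb x) (symb y)" using fin unfolding \<delta>_def by (intro Min_le) (auto intro!: rev_image_eqI)
      also have "\<dots> \<le> dist x y" using d[OF symb_in symb_in ne] xy(1,2) in_T_symb by blast
      finally show False using xy by simp
    qed
  qed
qed

section \<open>Prescribed itineraries and compact cylinders\<close>

lemma itin_finite_surj:
  assumes "\<And>j. j < n \<Longrightarrow> w j \<in> {1..m}"
  shows "\<exists>x\<in>X. \<forall>j<n. itin x j = w j"
  using assms
proof (induction n arbitrary: w)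
  case 0
  then show ?case using X_nonempty by auto
next
  case (Suc n)
  obtain x where x: "x \<in> X" "\<And>j. j < n \<Longrightarrow> itin x j = w (Suc j)"
    using Suc.IH[of "\<lambda>j. w (Suc j)"] Suc.prems by auto
  have "w 0 \<in> {1..m}" using Suc.prems by simp
  then show ?case using x T_in_X itin_T by (intro bexI[of _ "T (w 0) x"]) (auto split: nat.split)
qed

text \<open>The maps \<open>T i\<close> are the inverse branches of \<open>f\<close>. Preimages thus
  become finite unions of continuous images, which carries compactness from \<open>S\<close> to its
  preimage.\<close>

lemma preimage_eq: "{x \<in> X. f x \<in> S} = (\<Union>i\<in>{1..m}. T i ` S)" if "S \<subseteq> X"
proof -
  have "x \<in> (\<Union>i\<in>{1..m}. T i ` S)" if "x \<in> X" "f x \<in> S" for x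
    using T_symb_f[OF that(1)] symb_in[OF that(1)] that(2)
    by (intro UN_I[of "symb x"]) (metis imageI)+
  then show ?thesis using that T_in_X f_T by auto
qed

lemma compact_funpow_preimage:
  assumes "compact S" "S \<subseteq> X"
  shows "compact {x \<in> X. (f ^^ n) x \<in> S}"
  using assms
proof (induction n arbitrary: S)
  case 0
  then have "{x \<in> X. (f ^^ 0) x \<in> S} = S" by auto
  then show ?case using 0 by simp
next
  case (Suc n)
  have "{x \<in> X. (f ^^ Suc n) x \<in> S} = {x \<in> X. (f ^^ n) x \<in> {x \<in> X. f x \<in> S}}"
    by (auto simp: funpow_f_in_X)
  moreover have "compact {x \<in> X. f x \<in> S}"
    unfolding preimage_eq[OF Suc.prems(2)] using Suc.prems by (intro compact_UN compact_T) auto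
  ultimately show ?case using Suc.IH[of "{x \<in> X. f x \<in> S}"] by simp
qed

lemma compact_itin_eq:
  assumes "i \<in> {1..m}"
  shows "compact {x \<in> X. itin x j = i}"
proof -
  have "(f ^^ j) x \<in> T i ` X \<longleftrightarrow> itin x j = i" if "x \<in> X" for x
    using symbI[OF assms] in_T_symb[OF funpow_f_in_X[OF that]] by (auto simp: itin_def)
  then have "{x \<in> X. itin x j = i} = {x \<in> X. (f ^^ j) x \<in> T i ` X}"
    by auto
  then show ?thesis
    using assms T_in_X compact_X by (auto intro!: compact_funpow_preimage compact_T)
qed

lemma itin_surj:
  assumes "\<And>j. w j \<in> {1..m}"
  obtains x where "x \<in> X" "itin x = w"
proof -
  \<comment> \<open>Intersecting with \<open>X\<close> matters at \<open>n = 0\<close>, where the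
    intersection over the empty index set is the whole space.\<close>
  define F where "F n = X \<inter> (\<Inter>j\<in>{..<n}. {x \<in> X. itin x j = w j})" for n
  have "\<Inter> (range F) \<noteq> {}"
  proof (rule compact_nest)
    show "compact (F n)" for n
      unfolding F_def using assms compact_X
      by (intro compact_Int_closed closed_INT ballI compact_imp_closed compact_itin_eq)
    show "F n \<noteq> {}" for n
      using itin_finite_surj[of n w] assms by (auto simp: F_def)
    show "F n \<subseteq> F k" if "k \<le> n" for k n
      using that by (auto simp: F_def)
  qed
  then obtain x where x: "\<And>n. x \<in> F n" by blast
  have "itin x j = w j" for j using x[of "Suc j"] by (simp add: F_def)
  then show ?thesis using x[of 0] that by (auto simp: F_def)
qed

text \<open>Any finite word can be prepended to a point of \<open>N\<close> without leaving
  \<open>N\<close>, so \<open>N\<close> meets every cylinder, and long cylinders are small.\<close>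

lemma dense_if_T_invariant:
  assumes "N \<noteq> {}" "N \<subseteq> X" "\<And>i x. i \<in> {1..m} \<Longrightarrow> x \<in> N \<Longrightarrow> T i x \<in> N"
  shows "X \<subseteq> closure N"
proof
  fix x assume x: "x \<in> X"
  have approx: "\<exists>y\<in>N. \<forall>j<n. itin y j = itin x j" if "x \<in> X" for x n
    using that
  proof (induction n arbitrary: x)
    case 0 then show ?case using assms(1) by auto
  next
    case (Suc n)
    obtain y where y: "y \<in> N" "\<forall>j<n. itin y j = itin (f x) j" using Suc f_in_X by blast
    then show ?case
      using assms(2,3) symb_in[OF Suc.prems]
      by (intro bexI[of _ "T (symb x) y"]) (auto simp: itin_T itin_0 itin_f split: nat.split)
  qed
  have "\<exists>y\<in>N. dist y x < e" if e: "0 < e" for e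
  proof -
    obtain k where k: "\<And>x y. x \<in> X \<Longrightarrow> y \<in> X \<Longrightarrow> (\<And>j. j < k \<Longrightarrow> itin x j = itin y j) \<Longrightarrow> dist x y < e"
      using itin_determines_nearby[OF e] by blast
    then show ?thesis using approx[OF x, of k] assms(2) x by blast
  qed
  then show "x \<in> closure N" by (simp add: closure_approachable)
qed

end


section \<open>Upper bounds for entropy\<close>

lemma infsum_ennreal_finite_le_card:
  fixes F :: "'a \<Rightarrow> ennreal"
  assumes "finite G" "\<And>s. s \<in> G \<Longrightarrow> F s \<le> C"
  shows "infsum F G \<le> of_nat (card G) * C"
  using assms sum_bounded_above[of G F C] by simp

text \<open>Raising \<open>n\<close> leaves fewer admissible collections. The limit in
  \<open>cover_measure\<close> therefore exists and is a supremum.\<close>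

lemma incseq_cover_measure_bounds:
  "incseq (\<lambda>n. INF G\<in>string_covers X f \<U> Z n. (\<Sum>\<^sub>\<infinity>s\<in>G. ennreal (exp (- \<alpha> * real (length s)))))"
  by (intro incseq_SucI INF_superset_mono) (auto simp: string_covers_def)

text \<open>Since the limit is a supremum, it suffices to bound the term at \<open>n = 0\<close>,
  where string lengths are unrestricted.\<close>

lemma cover_measure_ge:
  assumes "\<And>G. countable G \<Longrightarrow> G \<subseteq> lists \<U> \<Longrightarrow> Z \<subseteq> (\<Union>s\<in>G. string_set X f s) \<Longrightarrow>
    C \<le> (\<Sum>\<^sub>\<infinity>s\<in>G. ennreal (exp (- \<alpha> * real (length s))))"
  shows "C \<le> cover_measure X f \<U> Z \<alpha>"
proof -
  let ?I = "\<lambda>n. INF G\<in>string_covers X f \<U> Z n. (\<Sum>\<^sub>\<infinity>s\<in>G. ennreal (exp (- \<alpha> * real (length s))))"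
  have "C \<le> ?I 0" using assms by (intro INF_greatest) (auto simp: string_covers_def)
  also have "\<dots> \<le> (SUP n. ?I n)" by (intro SUP_upper) simp
  also have "\<dots> = cover_measure X f \<U> Z \<alpha>"
    unfolding cover_measure_def
    by (rule limI[symmetric]) (rule LIMSEQ_SUP[OF incseq_cover_measure_bounds])
  finally show ?thesis .
qed

lemma cover_measure_eq_0:
  assumes "\<And>n. \<exists>G\<in>string_covers X f \<U> Z n. (\<Sum>\<^sub>\<infinity>s\<in>G. ennreal (exp (- \<alpha> * real (length s)))) \<le> ennreal (u n)"
    and "u \<longlonglongrightarrow> 0"
  shows "cover_measure X f \<U> Z \<alpha> = 0"
  unfolding cover_measure_def
proof (intro limI)
  let ?I = "\<lambda>n. INF G\<in>string_covers X f \<U> Z n. (\<Sum>\<^sub>\<infinity>s\<in>G. ennreal (exp (- \<alpha> * real (length s))))"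
  have "?I n \<le> ennreal (u n)" for n
    using assms(1)[of n] by (meson INF_lower2)
  moreover have "(\<lambda>n. ennreal (u n)) \<longlonglongrightarrow> 0"
    using assms(2) by (metis ennreal_0 tendsto_ennrealI)
  ultimately show "?I \<longlonglongrightarrow> 0"
    by (intro tendsto_sandwich[of "\<lambda>_. 0" ?I _ "\<lambda>n. ennreal (u n)"]) auto
qed

text \<open>Shows that the filter in \<open>subset_entropy\<close> is nontrivial, so that its
  \<open>Lim\<close> is determined. Radius \<open>e/3\<close> gives diameters at most
  \<open>2 * (e/3)\<close>, and this stays strictly below \<open>e\<close> after the
  supremum.\<close>

lemma small_cover_exists:
  assumes "X \<noteq> {}" "0 < e"
  shows "\<exists>\<U>. open_cover X \<U> \<and> 0 \<le> cover_diam \<U> \<and> cover_diam \<U> < e"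
proof (intro exI conjI)
  let ?\<U> = "(\<lambda>x. X \<inter> ball x (e/3)) ` X"
  show "open_cover X ?\<U>"
    using assms by (auto simp: open_cover_def)
  have d: "diameter U \<le> 2 * (e/3)" if "U \<in> ?\<U>" for U
  proof -
    from that obtain x where U: "U = X \<inter> ball x (e/3)" by blast
    have "dist y z \<le> 2 * (e/3)" if "y \<in> U" "z \<in> U" for y z
      using dist_triangle2[of y z x] that by (simp add: U dist_commute)
    then have "(SUP (y, z)\<in>U \<times> U. dist y z) \<le> 2 * (e/3)" if "U \<noteq> {}"
      using that by (intro cSUP_least) auto
    then show ?thesis
      unfolding diameter_def using assms(2) by auto
  qed
  then have "cover_diam ?\<U> \<le> 2 * (e/3)"
    unfolding cover_diam_def using assms by (intro cSUP_least) auto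
  then show "cover_diam ?\<U> < e" using assms by simp
  obtain x where "x \<in> X" using assms by blast
  have "0 \<le> diameter (X \<inter> ball x (e/3))" by (rule diameter_ge_0) (meson bounded_ball bounded_Int)
  also have "\<dots> \<le> cover_diam ?\<U>"
    unfolding cover_diam_def using d \<open>x \<in> X\<close> by (intro cSUP_upper bdd_aboveI2[where M="2*(e/3)"]) auto
  finally show "0 \<le> cover_diam ?\<U>" .
qed

lemma subset_entropy_eqI:
  assumes "X \<noteq> {}" "0 < \<delta>"
    and "\<And>\<U>. open_cover X \<U> \<Longrightarrow> cover_diam \<U> < \<delta> \<Longrightarrow> cover_entropy X f \<U> Z = h"
  shows "subset_entropy X f Z = h"
  unfolding subset_entropy_def
proof (rule tendsto_Lim)
  let ?F = "inf (filtercomap cover_diam (nhds 0)) (principal {\<U>. open_cover X \<U>})"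
  show "?F \<noteq> bot"
  proof
    assume "?F = bot"
    then have "eventually (\<lambda>_. False) ?F" by simp
    then obtain Q where Q: "eventually Q (nhds (0::real))"
        "\<And>\<U>. Q (cover_diam \<U>) \<Longrightarrow> \<not> open_cover X \<U>"
      by (auto simp: eventually_inf_principal eventually_filtercomap)
    then obtain e where e: "0 < e" "\<And>d. dist d 0 < e \<Longrightarrow> Q d"
      by (auto simp: eventually_nhds_metric)
    obtain \<U> where "open_cover X \<U>" "0 \<le> cover_diam \<U>" "cover_diam \<U> < e"
      using small_cover_exists[OF assms(1) e(1)] by blast
    then show False using Q(2)[of \<U>] e(2)[of "cover_diam \<U>"] by (simp add: dist_real_def)
  qed
  have "eventually (\<lambda>d. d < \<delta>) (nhds 0)"
    using assms(2) eventually_nhds_in_open[of "{..<\<delta>}" 0] by simp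
  then have "eventually (\<lambda>\<U>. cover_entropy X f \<U> Z = h) ?F"
    unfolding eventually_inf_principal eventually_filtercomap
    by (intro exI[of _ "\<lambda>d. d < \<delta>"]) (auto simp: assms(3))
  then show "((\<lambda>\<U>. cover_entropy X f \<U> Z) \<longlongrightarrow> h) ?F"
    by (rule tendsto_eventually)
qed

lemma dist_le_cover_diam:
  assumes "bounded X" "open_cover X \<U>" "U \<in> \<U>" "x \<in> U" "y \<in> U"
  shows "dist x y \<le> cover_diam \<U>"
proof -
  have sub: "V \<subseteq> X" if "V \<in> \<U>" for V using that assms(2) by (auto simp: open_cover_def)
  then have "dist x y \<le> diameter U"
    using assms by (meson bounded_subset diameter_bounded_bound)
  also have "\<dots> \<le> cover_diam \<U>"
    unfolding cover_diam_def using assms(1,3) sub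
    by (intro cSUP_upper bdd_aboveI2[where M="diameter X"] diameter_subset)
  finally show ?thesis .
qed

text \<open>Members of the cover are traces on \<open>X\<close> of open sets of the ambient space,
  to which the Heine-Borel lemma applies.\<close>

lemma open_cover_Lebesgue_number:
  assumes "compact X" "X \<noteq> {}" "open_cover X \<U>"
  obtains e where "0 < e" "\<And>x. x \<in> X \<Longrightarrow> \<exists>U\<in>\<U>. \<forall>y\<in>X. dist x y < e \<longrightarrow> y \<in> U"
proof -
  obtain O' where O': "\<And>U. U \<in> \<U> \<Longrightarrow> open (O' U) \<and> U = X \<inter> O' U"
    using assms(3) unfolding open_cover_def openin_open by metis
  have "X \<subseteq> \<Union>(O' ` \<U>)" using assms(3) O' unfolding open_cover_def by blast
  then obtain e where e: "0 < e" "\<And>x. x \<in> X \<Longrightarrow> \<exists>G\<in>O' ` \<U>. ball x e \<subseteq> G"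
    using Heine_Borel_lemma[OF assms(1), of "O' ` \<U>"] O' by blast
  have "\<exists>U\<in>\<U>. \<forall>y\<in>X. dist x y < e \<longrightarrow> y \<in> U" if x: "x \<in> X" for x
  proof -
    obtain U where U: "U \<in> \<U>" "ball x e \<subseteq> O' U" using e(2)[OF x] by blast
    then have "y \<in> U" if "y \<in> X" "dist x y < e" for y
      using O'[OF U(1)] that by auto
    then show ?thesis using U by blast
  qed
  then show ?thesis using that e(1) by blast
qed

context separated_ifs
begin

section \<open>Words, representatives and the upper bound \<open>ln m\<close>\<close>

definition words :: "nat \<Rightarrow> nat list set" where
  "words n = {w. set w \<subseteq> {1..m} \<and> length w = n}"

text \<open>A representative of the cylinder of \<open>w\<close>; meaningful if all letters of
  \<open>w\<close> lie in \<open>{1..m}\<close>.\<close>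

definition point :: "nat list \<Rightarrow> real ^ 'd" where
  "point w = (SOME x. x \<in> X \<and> (\<forall>j<length w. itin x j = w ! j))"

lemma finite_words: "finite (words n)" and card_words: "card (words n) = m ^ n"
  unfolding words_def by (simp_all add: finite_lists_length_eq card_lists_length_eq)

lemma
  assumes "w \<in> words n"
  shows point_in_X: "point w \<in> X" and itin_point: "j < n \<Longrightarrow> itin (point w) j = w ! j"
proof -
  have w: "length w = n" "set w \<subseteq> {1..m}"
    using assms by (simp_all add: words_def)
  then have "\<exists>x\<in>X. \<forall>j<length w. itin x j = w ! j"
    using nth_mem by (intro itin_finite_surj) blast
  then have "\<exists>x. x \<in> X \<and> (\<forall>j<length w. itin x j = w ! j)" by blast
  then have "point w \<in> X \<and> (\<forall>j<length w. itin (point w) j = w ! j)"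
    unfolding point_def by (rule someI_ex)
  then show "point w \<in> X" "j < n \<Longrightarrow> itin (point w) j = w ! j"
    using w by auto
qed

lemma itin_word: "x \<in> X \<Longrightarrow> map (itin x) [0..<n] \<in> words n"
  using itin_in by (auto simp: words_def)

text \<open>There are \<open>m ^ (n + k)\<close> cylinders of length \<open>n + k\<close>, and each
  lies in one string set of length \<open>n\<close>. The resulting sum is at most
  \<open>m ^ k\<close> times the \<open>n\<close>-th power of
  \<open>exp (ln m - \<alpha>) < 1\<close>.\<close>

lemma cover_measure_above_log:
  assumes \<alpha>: "ln m < \<alpha>" and Z: "Z \<subseteq> X" and \<U>: "open_cover X \<U>"
  shows "cover_measure X f \<U> Z \<alpha> = 0"
proof -
  obtain e where e: "0 < e" "\<And>x. x \<in> X \<Longrightarrow> \<exists>U\<in>\<U>. \<forall>y\<in>X. dist x y < e \<longrightarrow> y \<in> U"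
    using open_cover_Lebesgue_number[OF compact_X X_nonempty \<U>] by blast
  then obtain U where U: "\<And>x. x \<in> X \<Longrightarrow> U x \<in> \<U>"
      "\<And>x y. x \<in> X \<Longrightarrow> y \<in> X \<Longrightarrow> dist x y < e \<Longrightarrow> y \<in> U x"
    by metis
  obtain k where k: "\<And>x y. x \<in> X \<Longrightarrow> y \<in> X \<Longrightarrow> (\<And>j. j < k \<Longrightarrow> itin x j = itin y j) \<Longrightarrow> dist x y < e"
    using itin_determines_nearby[OF e(1)] by blast
  \<comment> \<open>The \<open>k\<close> extra symbols keep a point within the Lebesgue number
    \<open>e\<close> of the orbit of its representative for \<open>n\<close> steps, hence inside the
    cover elements chosen along that orbit.\<close>
  define S where "S n w = map (\<lambda>j. U ((f ^^ j) (point w))) [0..<n]" for n w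
  let ?u = "\<lambda>n. real m ^ k * exp (ln m - \<alpha>) ^ n"
  show ?thesis
  proof (rule cover_measure_eq_0)
    fix n
    let ?G = "S n ` words (n + k)"
    have "x \<in> string_set X f (S n (map (itin x) [0..<n+k]))" (is "_ \<in> string_set X f (S n ?w)") if x: "x \<in> X" for x
    proof -
      note w = itin_word[OF x, of "n + k"]
      have "(f ^^ j) x \<in> U ((f ^^ j) (point ?w))" if "j < n" for j
        using that x itin_point[OF w] point_in_X[OF w]
        by (intro U(2) k) (auto simp: funpow_f_in_X itin_funpow simp del: upt_Suc)
      then show ?thesis using x by (auto simp: string_set_def S_def)
    qed
    then have "Z \<subseteq> (\<Union>s\<in>?G. string_set X f s)" using Z itin_word by blast
    moreover have "?G \<subseteq> lists \<U>"
      using U(1) point_in_X funpow_f_in_X by (auto simp: S_def)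
    moreover have fin: "finite ?G" using finite_words by simp
    ultimately have "?G \<in> string_covers X f \<U> Z n"
      by (auto simp: string_covers_def S_def countable_finite)
    moreover have "(\<Sum>\<^sub>\<infinity>s\<in>?G. ennreal (exp (- \<alpha> * real (length s)))) \<le> ennreal (?u n)"
    proof -
      have "(\<Sum>\<^sub>\<infinity>s\<in>?G. ennreal (exp (- \<alpha> * real (length s)))) \<le> of_nat (card ?G) * ennreal (exp (- \<alpha> * n))"
        using fin by (intro infsum_ennreal_finite_le_card) (auto simp: S_def)
      also have "\<dots> = ennreal (real (card ?G) * exp (- \<alpha> * n))"
        by (simp add: ennreal_mult ennreal_of_nat_eq_real_of_nat)
      also have "\<dots> \<le> ennreal (real m ^ (n + k) * exp (- \<alpha> * n))"
        using card_image_le[OF finite_words, of "S n" "n + k"]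
        by (intro ennreal_leI mult_right_mono) (auto simp: card_words simp flip: of_nat_power)
      also have "real m ^ (n + k) * exp (- \<alpha> * n) = ?u n"
      proof -
        have "exp (ln m - \<alpha>) = m * exp (- \<alpha>)"
          using two_le_m by (simp add: exp_diff exp_minus divide_inverse)
        moreover have "exp (- \<alpha> * n) = exp (- \<alpha>) ^ n"
          using exp_of_nat_mult[of n "- \<alpha>"] by (simp add: mult.commute)
        ultimately show ?thesis by (simp only: power_add power_mult_distrib mult_ac)
      qed
      finally show ?thesis .
    qed
    ultimately show "\<exists>G\<in>string_covers X f \<U> Z n.
        (\<Sum>\<^sub>\<infinity>s\<in>G. ennreal (exp (- \<alpha> * real (length s)))) \<le> ennreal (?u n)" by blast
  next
    have "?u \<longlonglongrightarrow> real m ^ k * 0"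
      using \<alpha> by (intro tendsto_mult tendsto_const LIMSEQ_realpow_zero) auto
    then show "?u \<longlonglongrightarrow> 0" by simp
  qed
qed

text \<open>The upper bound holds for every \<open>Z \<subseteq> X\<close>; only positivity below
  \<open>ln m\<close>, for fine covers, remains to be supplied.\<close>

lemma subset_entropy_eq_log:
  assumes Z: "Z \<subseteq> X" and "0 < \<delta>"
    and pos: "\<And>\<U> \<alpha>. open_cover X \<U> \<Longrightarrow> cover_diam \<U> < \<delta> \<Longrightarrow> \<alpha> < ln m \<Longrightarrow>
      cover_measure X f \<U> Z \<alpha> \<noteq> 0"
  shows "subset_entropy X f Z = ereal (ln m)"
proof (rule subset_entropy_eqI[OF X_nonempty assms(2)])
  fix \<U> assume \<U>: "open_cover X \<U>" "cover_diam \<U> < \<delta>"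
  show "cover_entropy X f \<U> Z = ereal (ln m)"
    unfolding cover_entropy_def
  proof (rule antisym)
    show "Inf {ereal \<alpha> |\<alpha>. cover_measure X f \<U> Z \<alpha> = 0} \<le> ereal (ln m)"
    proof (rule ereal_le_epsilon2)
      fix e :: real assume "0 < e"
      then have "cover_measure X f \<U> Z (ln m + e) = 0"
        using cover_measure_above_log[OF _ Z \<U>(1)] by simp
      then show "Inf {ereal \<alpha> |\<alpha>. cover_measure X f \<U> Z \<alpha> = 0} \<le> ereal (ln m) + ereal e"
        by (intro Inf_lower) auto
    qed
    show "ereal (ln m) \<le> Inf {ereal \<alpha> |\<alpha>. cover_measure X f \<U> Z \<alpha> = 0}"
    proof (rule Inf_greatest)
      fix a assume "a \<in> {ereal \<alpha> |\<alpha>. cover_measure X f \<U> Z \<alpha> = 0}"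
      then obtain \<alpha> where "a = ereal \<alpha>" "cover_measure X f \<U> Z \<alpha> = 0" by blast
      then show "ereal (ln m) \<le> a" using pos[OF \<U>, of \<alpha>] by (cases "\<alpha> < ln m") auto
    qed
  qed
qed

section \<open>Topological entropy through separated sets\<close>

lemma card_separated_le:
  assumes "0 < \<epsilon>"
  obtains k where "\<And>n E. separated_set X f n \<epsilon> E \<Longrightarrow> card E \<le> m ^ (n + k)"
proof -
  obtain k where k: "\<And>x y. x \<in> X \<Longrightarrow> y \<in> X \<Longrightarrow> (\<And>j. j < k \<Longrightarrow> itin x j = itin y j) \<Longrightarrow> dist x y < \<epsilon>"
    using itin_determines_nearby[OF assms] by blast
  show ?thesis
  proof
    fix n E assume E: "separated_set X f n \<epsilon> E"
    then have EX: "E \<subseteq> X" by (simp add: separated_set_def)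
    let ?c = "\<lambda>x. map (itin x) [0..<n + k]"
    \<comment> \<open>Points sharing \<open>n + k\<close> symbols stay
      \<open>\<epsilon>\<close>-close for \<open>n\<close> steps, so a separated set contains at
      most one point of each word.\<close>
    have "inj_on ?c E"
    proof (rule inj_onI, rule ccontr)
      fix x y assume xy: "x \<in> E" "y \<in> E" "?c x = ?c y" "x \<noteq> y"
      then have "itin x j = itin y j" if "j < n + k" for j
        using that by (auto simp: list_eq_iff_nth_eq simp del: upt_Suc)
      then have "dist ((f ^^ j) x) ((f ^^ j) y) < \<epsilon>" if "j < n" for j
        using that xy EX by (intro k) (auto simp: funpow_f_in_X itin_funpow)
      then show False using E xy unfolding separated_set_def by (meson not_less_iff_gr_or_eq)
    qed
    then have "card E \<le> card (words (n + k))"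
      using EX itin_word by (intro card_inj_on_le[of ?c] finite_words) auto
    then show "card E \<le> m ^ (n + k)" by (simp add: card_words)
  qed
qed

text \<open>Representatives of distinct words of length \<open>n\<close> differ in a symbol at some
  time \<open>j < n\<close>, and there their orbits are at least
  \<open>\<delta> > \<epsilon>\<close> apart. The upper bound also makes the supremum in
  \<open>nat\<close> well behaved.\<close>

lemma max_separated_bounds:
  assumes \<delta>: "\<And>x y. x \<in> X \<Longrightarrow> y \<in> X \<Longrightarrow> dist x y < \<delta> \<Longrightarrow> symb x = symb y"
    and \<epsilon>: "0 < \<epsilon>" "\<epsilon> < \<delta>"
  obtains k where "\<And>n. m ^ n \<le> max_separated X f n \<epsilon>" "\<And>n. max_separated X f n \<epsilon> \<le> m ^ (n + k)"
proof -
  obtain k where k: "\<And>n E. separated_set X f n \<epsilon> E \<Longrightarrow> card E \<le> m ^ (n + k)"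
    using card_separated_le[OF \<epsilon>(1)] by blast
  show ?thesis
  proof
    fix n
    let ?C = "{card E |E. separated_set X f n \<epsilon> E}"
    have bdd: "bdd_above ?C" using k by (auto intro!: bdd_aboveI[where M="m ^ (n + k)"])
    have inj: "inj_on point (words n)"
      by (rule inj_onI) (metis (mono_tags, lifting) itin_point words_def mem_Collect_eq nth_equalityI)
    have "separated_set X f n \<epsilon> (point ` words n)"
      unfolding separated_set_def
    proof (intro conjI ballI impI)
      fix x y assume xy: "x \<in> point ` words n" "y \<in> point ` words n" "x \<noteq> y"
      then obtain v w where vw: "v \<in> words n" "w \<in> words n" "x = point v" "y = point w" "v \<noteq> w" by auto
      then obtain j where "j < n" "v ! j \<noteq> w ! j"
        unfolding words_def by (metis (mono_tags, lifting) mem_Collect_eq nth_equalityI)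
      then have "itin x j \<noteq> itin y j" using vw itin_point by simp
      then have "\<delta> \<le> dist ((f ^^ j) x) ((f ^^ j) y)"
        using \<delta>[of "(f ^^ j) x" "(f ^^ j) y"] vw point_in_X funpow_f_in_X
        unfolding itin_def by (meson not_le_imp_less)
      then show "\<exists>j<n. \<epsilon> < dist ((f ^^ j) x) ((f ^^ j) y)" using \<epsilon> \<open>j < n\<close> by force
    qed (use finite_words point_in_X in auto)
    then have "card (point ` words n) \<in> ?C" by blast
    then show "m ^ n \<le> max_separated X f n \<epsilon>"
      unfolding max_separated_def card_image[OF inj] card_words by (rule cSup_upper[OF _ bdd])
    show "max_separated X f n \<epsilon> \<le> m ^ (n + k)"
      unfolding max_separated_def using k \<open>card (point ` words n) \<in> ?C\<close> by (intro cSup_least) auto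
  qed
qed

lemma topological_entropy_eq_log: "topological_entropy X f = ereal (ln m)"
proof -
  obtain \<delta> where \<delta>: "0 < \<delta>" "\<And>x y. x \<in> X \<Longrightarrow> y \<in> X \<Longrightarrow> dist x y < \<delta> \<Longrightarrow> symb x = symb y"
    using symb_eq_if_close by blast
  have "limsup (\<lambda>n. ereal (ln (real (max_separated X f n \<epsilon>)) / real n)) = ereal (ln m)"
    if \<epsilon>: "0 < \<epsilon>" "\<epsilon> < \<delta>" for \<epsilon>
  proof -
    obtain k where k: "\<And>n. m ^ n \<le> max_separated X f n \<epsilon>" "\<And>n. max_separated X f n \<epsilon> \<le> m ^ (n + k)"
      using max_separated_bounds[OF \<delta>(2) \<epsilon>] by blast
    have pos: "0 < m" using two_le_m by simp
    have "(\<lambda>n. ln (real (max_separated X f n \<epsilon>)) / real n) \<longlonglongrightarrow> ln m"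
    proof (rule tendsto_sandwich)
      show "eventually (\<lambda>n. ln m \<le> ln (real (max_separated X f n \<epsilon>)) / real n) sequentially"
        using eventually_gt_at_top[of 0]
      proof eventually_elim
        case (elim n)
        have "real n * ln m = ln (real (m ^ n))" using pos by (simp add: ln_realpow)
        also have "\<dots> \<le> ln (real (max_separated X f n \<epsilon>))"
          using k(1)[of n] pos by (intro ln_mono) (simp_all flip: of_nat_power)
        finally show ?case using elim by (simp add: field_simps)
      qed
      show "eventually (\<lambda>n. ln (real (max_separated X f n \<epsilon>)) / real n \<le> ln m + k * ln m / n) sequentially"
        using eventually_gt_at_top[of 0]
      proof eventually_elim
        case (elim n)
        have "0 < max_separated X f n \<epsilon>" using k(1)[of n] pos by (meson less_le_trans zero_less_power)
        then have "ln (real (max_separated X f n \<epsilon>)) \<le> ln (real (m ^ (n + k)))"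
          using k(2)[of n] by (intro ln_mono) (auto simp flip: of_nat_power)
        also have "\<dots> = (n + k) * ln m" using pos by (simp add: ln_realpow)
        finally show ?case using elim by (simp add: field_simps)
      qed
      have "(\<lambda>n. ln m + k * ln m / real n) \<longlonglongrightarrow> ln m + 0"
        by (intro tendsto_add tendsto_const lim_const_over_n)
      then show "(\<lambda>n. ln m + k * ln m / real n) \<longlonglongrightarrow> ln m" by simp
    qed auto
    then show ?thesis by (intro lim_imp_Limsup) auto
  qed
  then have "eventually (\<lambda>\<epsilon>. limsup (\<lambda>n. ereal (ln (real (max_separated X f n \<epsilon>)) / real n)) = ereal (ln m)) (at_right 0)"
    using \<delta>(1) by (intro eventually_at_rightI[of 0 \<delta>]) auto
  then show ?thesis
    unfolding topological_entropy_def by (intro tendsto_Lim tendsto_eventually) auto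
qed

end


section \<open>Lower bounds for entropy\<close>

lemma infsum_ennreal_ge_finite:
  fixes g :: "'a \<Rightarrow> ennreal"
  assumes "finite F" "F \<subseteq> A"
  shows "sum g F \<le> infsum g A"
proof -
  have "sum g F = infsum g F" using assms by simp
  also have "\<dots> \<le> infsum g A"
    using assms by (intro infsum_mono_neutral nonneg_summable_on_complete) auto
  finally show ?thesis .
qed

lemma infsum_cmult_ennreal:
  fixes g :: "'a \<Rightarrow> ennreal"
  shows "(\<Sum>\<^sub>\<infinity>s\<in>A. c * g s) = c * (\<Sum>\<^sub>\<infinity>s\<in>A. g s)"
proof -
  have "(\<Sum>\<^sub>\<infinity>s\<in>A. c * g s) = (SUP F\<in>{F. finite F \<and> F \<subseteq> A}. c * sum g F)"
    by (simp add: nonneg_infsum_complete sum_distrib_left)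
  also have "\<dots> = c * (SUP F\<in>{F. finite F \<and> F \<subseteq> A}. sum g F)"
    by (rule SUP_mult_left_ennreal[symmetric])
  finally show ?thesis by (simp add: nonneg_infsum_complete)
qed

text \<open>Countable subadditivity after enumerating \<open>G\<close>. The enumeration is a
  bijection from all of \<open>nat\<close> only for infinite \<open>G\<close>, hence the case
  split.\<close>

lemma emeasure_UN_le_infsum:
  assumes "countable G" and A: "\<And>s. s \<in> G \<Longrightarrow> A s \<in> sets M"
  shows "emeasure M (\<Union>s\<in>G. A s) \<le> (\<Sum>\<^sub>\<infinity>s\<in>G. emeasure M (A s))"
proof (cases "finite G")
  case True
  then show ?thesis using emeasure_subadditive_finite[of G A M] A by auto
next
  case False
  let ?s = "from_nat_into G"
  have bij: "bij_betw ?s UNIV G" using False assms(1) by (intro bij_betw_from_nat_into)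
  have "emeasure M (\<Union>s\<in>G. A s) = emeasure M (\<Union>n. A (?s n))"
    using bij by (simp add: bij_betw_def flip: image_image)
  also have "\<dots> \<le> (\<Sum>n. emeasure M (A (?s n)))"
    using A bij by (intro emeasure_subadditive_countably) (auto simp: bij_betw_def)
  also have "\<dots> \<le> (\<Sum>\<^sub>\<infinity>s\<in>G. emeasure M (A s))"
  proof (rule suminf_le_const[OF summableI])
    fix n
    have "(\<Sum>i<n. emeasure M (A (?s i))) = (\<Sum>s\<in>?s ` {..<n}. emeasure M (A s))"
      using bij by (subst sum.reindex) (auto simp: bij_betw_def intro: inj_on_subset)
    also have "\<dots> \<le> (\<Sum>\<^sub>\<infinity>s\<in>G. emeasure M (A s))"
      using bij by (intro infsum_ennreal_ge_finite) (auto simp: bij_betw_def)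
    finally show "(\<Sum>i<n. emeasure M (A (?s i))) \<le> (\<Sum>\<^sub>\<infinity>s\<in>G. emeasure M (A s))" .
  qed
  finally show ?thesis .
qed

text \<open>The weight of \<open>s\<close> bounds the uniform product measure of the cylinder that
  fixes the first \<open>r s\<close> coordinates, and these cylinders cover a space of measure
  1.\<close>

lemma sum_weights_of_cylinder_cover_ge_1:
  fixes W :: "'a set" and r :: "'s \<Rightarrow> nat" and w :: "'s \<Rightarrow> nat \<Rightarrow> 'a"
  assumes W: "finite W" "W \<noteq> {}" and G: "countable G"
    and cover: "\<And>v. (\<And>i. v i \<in> W) \<Longrightarrow> \<exists>s\<in>G. \<forall>i<r s. v i = w s i"
  shows "1 \<le> (\<Sum>\<^sub>\<infinity>s\<in>G. ennreal ((1 / card W) ^ r s))"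
proof -
  let ?\<mu> = "uniform_count_measure W"
  define M where "M = (\<Pi>\<^sub>M (i::nat) \<in> UNIV. ?\<mu>)"
  have prob: "prob_space ?\<mu>" using W by (intro prob_space_uniform_count_measure)
  then interpret M: prob_space M unfolding M_def by (intro prob_space_PiM)
  \<comment> \<open>\<open>w s i\<close> is not assumed to lie in \<open>W\<close>; the intersection
    keeps the factor measurable and at worst makes the cylinder empty.\<close>
  define C where "C s = prod_emb UNIV (\<lambda>_. ?\<mu>) {..<r s} (\<Pi>\<^sub>E i\<in>{..<r s}. {w s i} \<inter> W)" for s
  have C_sets: "C s \<in> sets M" for s
    unfolding C_def M_def by (intro sets_PiM_I) (auto simp: sets_uniform_count_measure)
  have C_measure: "emeasure M (C s) \<le> ennreal ((1 / card W) ^ r s)" for s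
  proof -
    have "emeasure M (C s) = (\<Prod>i<r s. emeasure ?\<mu> ({w s i} \<inter> W))"
      unfolding C_def M_def using prob by (intro emeasure_PiM_emb) (auto simp: sets_uniform_count_measure)
    also have "\<dots> \<le> (\<Prod>i<r s. ennreal (1 / card W))"
    proof (rule prod_mono_ennreal)
      fix i
      have "card ({w s i} \<inter> W) \<le> 1" by (cases "w s i \<in> W") simp_all
      then show "emeasure ?\<mu> ({w s i} \<inter> W) \<le> ennreal (1 / card W)"
        using W by (subst emeasure_uniform_count_measure) (auto intro!: ennreal_leI divide_right_mono)
    qed
    also have "\<dots> = ennreal ((1 / card W) ^ r s)"
      by (simp add: ennreal_power)
    finally show ?thesis .
  qed
  have "space M \<subseteq> (\<Union>s\<in>G. C s)"
  proof
    fix v assume "v \<in> space M"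
    then have v: "v i \<in> W" for i
      by (auto simp: M_def space_PiM space_uniform_count_measure)
    then obtain s where "s \<in> G" "\<forall>i<r s. v i = w s i" using cover by blast
    then have "v \<in> C s"
      using v by (auto simp: C_def prod_emb_def space_uniform_count_measure restrict_def PiE_def extensional_def)
    then show "v \<in> (\<Union>s\<in>G. C s)" using \<open>s \<in> G\<close> by blast
  qed
  then have "1 \<le> emeasure M (\<Union>s\<in>G. C s)"
    using emeasure_mono[of "space M" "\<Union>s\<in>G. C s" M] G C_sets
    by (simp add: M.emeasure_space_1 sets.countable_UN' image_subset_iff)
  also have "\<dots> \<le> (\<Sum>\<^sub>\<infinity>s\<in>G. emeasure M (C s))"
    using G C_sets by (intro emeasure_UN_le_infsum)
  also have "\<dots> \<le> (\<Sum>\<^sub>\<infinity>s\<in>G. ennreal ((1 / card W) ^ r s))"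
    using C_measure by (intro infsum_mono nonneg_summable_on_complete) auto
  finally show ?thesis .
qed

text \<open>A string of length \<open>n\<close> contains only \<open>n div b\<close> full blocks;
  the rounding costs one factor \<open>N\<close>.\<close>

lemma pow_div_le_exp:
  fixes N \<alpha> :: real and b n :: nat
  assumes "1 \<le> N" "0 < b" "\<alpha> * b \<le> ln N"
  shows "(1 / N) ^ (n div b) \<le> N * exp (- \<alpha> * n)"
proof -
  have "\<alpha> * n \<le> ln N * (real n / b)"
    using mult_right_mono[OF assms(3), of "real n / b"] assms(2) by simp
  also have "\<dots> \<le> ln N * (n div b + 1)"
  proof (intro mult_left_mono)
    have "n \<le> (n div b + 1) * b"
      using div_mult_mod_eq[of n b] mod_less_divisor[OF assms(2), of n]
      unfolding distrib_right by linarith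
    then have "real n \<le> (n div b + 1) * b"
      by (simp only: of_nat_le_iff flip: of_nat_mult)
    then show "real n / b \<le> n div b + 1"
      using assms(2) by (simp add: field_simps)
  qed (use assms in auto)
  finally have "exp (\<alpha> * n) \<le> exp (ln N * real (n div b + 1))" by simp
  also have "\<dots> = N ^ (n div b + 1)"
    using assms exp_of_nat_mult[of "n div b + 1" "ln N"] by (simp add: mult.commute)
  finally show ?thesis
    using assms by (simp add: exp_minus power_one_over field_simps)
qed

context separated_ifs
begin

text \<open>When the cover is finer than \<open>\<delta>\<close>, a string determines all symbols of
  its points up to its length, and so the words in its full blocks. \<open>W\<close> acts as an
  alphabet of freely chosen words of length \<open>K\<close>, placed with period \<open>b\<close>;
  the remaining \<open>b - K\<close> symbols of each period may be anything.\<close>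

lemma cover_measure_pos:
  assumes \<delta>: "\<And>x y. x \<in> X \<Longrightarrow> y \<in> X \<Longrightarrow> dist x y < \<delta> \<Longrightarrow> symb x = symb y"
    and \<U>: "open_cover X \<U>" "cover_diam \<U> < \<delta>"
    and W: "finite W" "W \<noteq> {}"
    and K: "K \<le> b" "0 < b"
    and \<alpha>: "\<alpha> * b \<le> ln (card W)"
    and Z: "\<And>v. (\<And>i. v i \<in> W) \<Longrightarrow>
      \<exists>x\<in>Z. x \<in> X \<and> (\<forall>i. v i = map (\<lambda>j. itin x (i * b + j)) [0..<K])"
  shows "cover_measure X f \<U> Z \<alpha> \<noteq> 0"
proof -
  let ?N = "real (card W)"
  have N: "1 \<le> ?N" using W by (simp add: Suc_le_eq card_gt_0_iff)
  have "ennreal (1 / ?N) \<le> cover_measure X f \<U> Z \<alpha>"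
  proof (rule cover_measure_ge)
    fix G assume G: "countable G" "G \<subseteq> lists \<U>" "Z \<subseteq> (\<Union>s\<in>G. string_set X f s)"
    have same: "itin x j = itin y j"
      if "x \<in> string_set X f s" "y \<in> string_set X f s" "s \<in> G" "j < length s" for x y s j
    proof -
      have "s ! j \<in> \<U>" using that G(2) by (auto simp: lists_eq_set dest!: nth_mem)
      then have "dist ((f ^^ j) x) ((f ^^ j) y) \<le> cover_diam \<U>"
        using that compact_X \<U>(1)
        by (intro dist_le_cover_diam[of X \<U> "s ! j"]) (auto simp: string_set_def compact_imp_bounded)
      then show ?thesis
        using that \<U>(2) unfolding itin_def
        by (intro \<delta> funpow_f_in_X) (auto simp: string_set_def)
    qed
    \<comment> \<open>A reference point from which the words of the string are read. It is arbitrary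
      if the string set is empty, but only strings containing a point of \<open>Z\<close> are used
      below.\<close>
    define z where "z s = (SOME x. x \<in> string_set X f s)" for s
    define w where "w s i = map (\<lambda>j. itin (z s) (i * b + j)) [0..<K]" for s i
    have "1 \<le> (\<Sum>\<^sub>\<infinity>s\<in>G. ennreal ((1 / ?N) ^ (length s div b)))"
    proof (rule sum_weights_of_cylinder_cover_ge_1[OF W G(1)])
      fix v :: "nat \<Rightarrow> nat list" assume "\<And>i. v i \<in> W"
      then obtain x where x: "x \<in> Z" "\<And>i. v i = map (\<lambda>j. itin x (i * b + j)) [0..<K]"
        using Z[of v] by blast
      then obtain s where s: "s \<in> G" "x \<in> string_set X f s" using G(3) by blast
      have z: "z s \<in> string_set X f s" unfolding z_def using s(2) by (rule someI)
      have "v i = w s i" if i: "i < length s div b" for i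
      proof -
        have "Suc i * b \<le> length s div b * b" using i by (intro mult_right_mono) auto
        also have "\<dots> \<le> length s" by simp
        finally have "i * b + j < length s" if "j < K" for j using that K by simp
        then show ?thesis
          unfolding w_def x(2) using same[OF s(2) z s(1)] by simp
      qed
      then show "\<exists>s\<in>G. \<forall>i<length s div b. v i = w s i" using s(1) by blast
    qed
    also have "\<dots> \<le> (\<Sum>\<^sub>\<infinity>s\<in>G. ennreal ?N * ennreal (exp (- \<alpha> * real (length s))))"
      using pow_div_le_exp[OF N K(2) \<alpha>]
      by (intro infsum_mono nonneg_summable_on_complete) (auto simp flip: ennreal_mult intro!: ennreal_leI)
    also have "\<dots> = ennreal ?N * (\<Sum>\<^sub>\<infinity>s\<in>G. ennreal (exp (- \<alpha> * real (length s))))"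
      by (rule infsum_cmult_ennreal)
    finally have *: "1 \<le> ennreal ?N * (\<Sum>\<^sub>\<infinity>s\<in>G. ennreal (exp (- \<alpha> * real (length s))))" .
    have "ennreal (1 / ?N) \<le> ennreal (1 / ?N) * (ennreal ?N * (\<Sum>\<^sub>\<infinity>s\<in>G. ennreal (exp (- \<alpha> * real (length s)))))"
      using mult_left_mono[OF *, of "ennreal (1 / ?N)"] by simp
    also have "\<dots> = (\<Sum>\<^sub>\<infinity>s\<in>G. ennreal (exp (- \<alpha> * real (length s))))"
      using N by (simp add: mult.assoc[symmetric] ennreal_mult[symmetric])
    finally show "ennreal (1 / ?N) \<le> (\<Sum>\<^sub>\<infinity>s\<in>G. ennreal (exp (- \<alpha> * real (length s))))" .
  qed
  moreover have "0 < ennreal (1 / ?N)" using N by simp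
  ultimately show ?thesis by auto
qed

end


section \<open>Oscillation of averages\<close>

definition average :: "(nat \<Rightarrow> real) \<Rightarrow> nat \<Rightarrow> real" where
  "average a n = (\<Sum>j<n. a j) / real n"

definition oscillation :: "(nat \<Rightarrow> real) \<Rightarrow> ereal" where
  "oscillation u = limsup (\<lambda>n. ereal (u n)) - liminf (\<lambda>n. ereal (u n))"

lemma not_convergent_if_oscillation_pos:
  assumes "oscillation u = ereal r" "0 < r"
  shows "\<not> convergent u"
proof
  assume "convergent u"
  then obtain l where "u \<longlonglongrightarrow> l" by (auto simp: convergent_def)
  then have "(\<lambda>n. ereal (u n)) \<longlonglongrightarrow> ereal l" by simp
  then have "limsup (\<lambda>n. ereal (u n)) = ereal l" "liminf (\<lambda>n. ereal (u n)) = ereal l"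
    using lim_imp_Limsup[OF sequentially_bot] lim_imp_Liminf[OF sequentially_bot] by blast+
  then have "oscillation u = ereal l - ereal l"
    unfolding oscillation_def by simp
  then show False using assms by simp
qed

lemma oscillation_cong_tendsto:
  assumes "(\<lambda>n. u n - v n) \<longlonglongrightarrow> 0"
  shows "oscillation u = oscillation v"
proof -
  have lim: "(\<lambda>n. ereal (u n - v n)) \<longlonglongrightarrow> ereal 0" using assms by simp
  have "limsup (\<lambda>n. ereal (u n - v n) + ereal (v n)) = ereal 0 + limsup (\<lambda>n. ereal (v n))"
    using lim by (rule ereal_limsup_lim_add) auto
  moreover have "liminf (\<lambda>n. ereal (u n - v n) + ereal (v n)) = ereal 0 + liminf (\<lambda>n. ereal (v n))"
    using lim by (rule ereal_liminf_lim_add) auto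
  ultimately show ?thesis by (simp add: oscillation_def zero_ereal_def[symmetric])
qed

text \<open>The two sums differ by \<open>a n - a 0\<close>, which is bounded and disappears after
  division by \<open>n\<close>. This yields the invariance of \<open>osc\<close> under
  \<open>f\<close>.\<close>

lemma oscillation_average_shift:
  assumes "\<And>j. \<bar>a j\<bar> \<le> B"
  shows "oscillation (average (\<lambda>j. a (Suc j))) = oscillation (average a)"
proof (rule oscillation_cong_tendsto)
  have bound: "\<bar>average (\<lambda>j. a (Suc j)) n - average a n\<bar> \<le> 2 * B / n" for n
  proof -
    have "(\<Sum>j<n. a (Suc j)) - (\<Sum>j<n. a j) = a n - a 0"
      by (simp add: sum_subtractf[symmetric] sum_lessThan_telescope)
    then have "average (\<lambda>j. a (Suc j)) n - average a n = (a n - a 0) / n"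
      by (simp add: average_def diff_divide_distrib[symmetric])
    then show ?thesis using assms[of n] assms[of 0]
      by (simp add: divide_right_mono)
  qed
  show "(\<lambda>n. average (\<lambda>j. a (Suc j)) n - average a n) \<longlonglongrightarrow> 0"
    by (rule Lim_null_comparison[of _ "\<lambda>n. 2 * B / real n"])
       (use bound in \<open>auto intro: lim_const_over_n\<close>)
qed

section \<open>Averages that follow the sine of the logarithm\<close>

lemma limsup_ge_along:
  fixes u :: "nat \<Rightarrow> ereal"
  assumes "filterlim r at_top sequentially" "(\<lambda>k. u (r k)) \<longlonglongrightarrow> l"
  shows "l \<le> limsup u"
proof (rule ccontr)
  assume "\<not> l \<le> limsup u"
  then obtain z where z: "limsup u < z" "z < l" using dense[of "limsup u" l] by (auto simp: not_le)
  have "eventually (\<lambda>k. u (r k) < z) sequentially"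
    using Limsup_lessD[OF z(1)] assms(1) by (rule eventually_compose_filterlim)
  moreover have "eventually (\<lambda>k. z < u (r k)) sequentially"
    using assms(2) z(2) by (rule order_tendstoD)
  ultimately have "eventually (\<lambda>k. False) sequentially"
    by eventually_elim auto
  then show False by simp
qed

lemma limsup_sin_ln:
  assumes "0 \<le> Q"
  shows "limsup (\<lambda>n. ereal (P + Q * sin (ln (real n) - \<beta>))) = ereal (P + Q)"
proof (rule antisym)
  have "P + Q * sin (ln (real n) - \<beta>) \<le> P + Q" for n
    using assms by (simp add: mult_left_le)
  then show "limsup (\<lambda>n. ereal (P + Q * sin (ln (real n) - \<beta>))) \<le> ereal (P + Q)"
    by (intro Limsup_bounded) auto
  \<comment> \<open>The points where \<open>sin (y k - \<beta>) = 1\<close>; \<open>r k\<close> is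
    the integer just above \<open>exp (y k)\<close>.\<close>
  define y where "y k = \<beta> + pi / 2 + 2 * real k * pi" for k
  define r where "r k = nat \<lceil>exp (y k)\<rceil>" for k
  have y_lim: "filterlim y at_top sequentially"
  proof -
    have "filterlim (\<lambda>k. (\<beta> + pi / 2) + 2 * pi * real k) at_top sequentially"
      by (intro filterlim_tendsto_add_at_top[OF tendsto_const]
          filterlim_tendsto_pos_mult_at_top[OF tendsto_const _ filterlim_real_sequentially]) simp
    then show ?thesis by (simp add: y_def[abs_def] mult_ac)
  qed
  have r: "exp (y k) \<le> r k" "r k \<le> exp (y k) + 1" for k
  proof -
    have "real (r k) = of_int \<lceil>exp (y k)\<rceil>" by (simp add: r_def order_less_imp_le)
    then show "exp (y k) \<le> r k" "r k \<le> exp (y k) + 1" by linarith+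
  qed
  have "filterlim (\<lambda>k. real (r k)) at_top sequentially"
    using filterlim_at_top_mono[OF filterlim_compose[OF exp_at_top y_lim]] r(1) by simp
  then have r_lim: "filterlim r at_top sequentially"
    by (simp add: filterlim_sequentially_iff_filterlim_real)
  have diff: "(\<lambda>k. ln (real (r k)) - y k) \<longlonglongrightarrow> 0"
  proof (rule tendsto_sandwich[of "\<lambda>_. 0" _ _ "\<lambda>k. exp (- y k)"])
    have "0 \<le> ln (real (r k)) - y k \<and> ln (real (r k)) - y k \<le> exp (- y k)" for k
    proof -
      have pos: "0 < real (r k)" using r(1)[of k] exp_gt_zero[of "y k"] by linarith
      \<comment> \<open>Rounding up changes \<open>exp (y k)\<close> by at most 1, which changes its
        logarithm by at most \<open>exp (- y k)\<close>.\<close>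
      have "ln (real (r k)) - y k = ln (r k / exp (y k))"
        using pos by (simp add: ln_div)
      also have "\<dots> \<le> r k / exp (y k) - 1"
        using pos by (intro ln_le_minus_one) simp
      also have "\<dots> \<le> exp (- y k)"
        using divide_right_mono[OF r(2)[of k], of "exp (y k)"]
        by (simp add: exp_minus inverse_eq_divide add_divide_distrib)
      finally show ?thesis using r(1)[of k] pos by (simp add: ln_ge_iff)
    qed
    then show "eventually (\<lambda>k. 0 \<le> ln (real (r k)) - y k) sequentially"
      "eventually (\<lambda>k. ln (real (r k)) - y k \<le> exp (- y k)) sequentially" by auto
    show "(\<lambda>k. exp (- y k)) \<longlonglongrightarrow> 0"
      using y_lim by (intro filterlim_compose[OF exp_at_bot]) (simp add: filterlim_uminus_at_bot)
  qed auto
  have "sin (ln (real (r k)) - \<beta>) = cos (ln (real (r k)) - y k)" for k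
  proof -
    have "ln (real (r k)) - \<beta> = ((ln (real (r k)) - y k) + pi / 2) + 2 * real k * pi"
      by (simp add: y_def)
    moreover have "sin ((t + pi / 2) + 2 * real k * pi) = cos t" for t
      by (simp only: sin_add sin_2npi cos_2npi sin_pi_half cos_pi_half) simp
    ultimately show ?thesis by metis
  qed
  moreover have "(\<lambda>k. P + Q * cos (ln (real (r k)) - y k)) \<longlonglongrightarrow> P + Q * cos 0"
    using diff by (intro tendsto_intros)
  ultimately have "(\<lambda>k. ereal (P + Q * sin (ln (real (r k)) - \<beta>))) \<longlonglongrightarrow> ereal (P + Q)"
    by simp
  \<comment> \<open>Divergence of \<open>r\<close> is all that this comparison asks; strict
    monotonicity is not at issue.\<close>
  with r_lim show "ereal (P + Q) \<le> limsup (\<lambda>n. ereal (P + Q * sin (ln (real n) - \<beta>)))"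
    by (rule limsup_ge_along)
qed

text \<open>Negating the sine amounts to shifting \<open>\<beta>\<close> by \<open>pi\<close>, so
  the liminf follows from the formula for the limsup.\<close>

lemma oscillation_sin_ln:
  assumes "0 \<le> Q"
  shows "oscillation (\<lambda>n. P + Q * sin (ln (real n) - \<beta>)) = ereal (2 * Q)"
proof -
  have "limsup (\<lambda>n. - ereal (P + Q * sin (ln (real n) - \<beta>))) =
      limsup (\<lambda>n. ereal (- P + Q * sin (ln (real n) - (\<beta> + pi))))"
  proof -
    have "sin (t - (\<beta> + pi)) = - sin (t - \<beta>)" for t
      using sin_minus_pi[of "t - \<beta>"] by (simp add: diff_diff_eq)
    then show ?thesis by simp
  qed
  also have "\<dots> = ereal (- P + Q)" using assms by (rule limsup_sin_ln)
  finally have "- liminf (\<lambda>n. ereal (P + Q * sin (ln (real n) - \<beta>))) = ereal (- P + Q)"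
    by (simp only: ereal_Limsup_uminus)
  then have "liminf (\<lambda>n. ereal (P + Q * sin (ln (real n) - \<beta>))) = ereal (P - Q)"
    by (cases "liminf (\<lambda>n. ereal (P + Q * sin (ln (real n) - \<beta>)))") auto
  then show ?thesis using limsup_sin_ln[OF assms] by (simp add: oscillation_def)
qed

text \<open>The markers are the increments of \<open>\<lfloor>wave A n\<rfloor>\<close>, whose averages follow \<open>1/2 + A sin (ln n)\<close>; for
  \<open>A \<le> 1/4\<close> the derivative of \<open>wave A\<close> stays in \<open>[0, 1]\<close>. At the origin \<open>ln 0 = 0\<close> gives \<open>wave A 0 = 0\<close>.\<close>

definition wave :: "real \<Rightarrow> real \<Rightarrow> real" where
  "wave A x = x * (1 / 2 + A * sin (ln x))"

lemma wave_increment: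
  assumes A: "0 \<le> A" "A \<le> 1 / 4" and x: "0 < x" "x \<le> y"
  shows "wave A x \<le> wave A y" "wave A y - wave A x \<le> y - x"
proof -
  define D where "D t = 1 / 2 + A * sin (ln t) + A * cos (ln t)" for t
  have D: "(wave A has_real_derivative D t) (at t)" if "x \<le> t" for t
    unfolding wave_def D_def using that x
    by (auto intro!: derivative_eq_intros simp: field_simps)
  have bound: "0 \<le> D t \<and> D t \<le> 1" for t
  proof -
    have "\<bar>A * sin (ln t)\<bar> \<le> 1 / 4 * 1" "\<bar>A * cos (ln t)\<bar> \<le> 1 / 4 * 1"
      using A unfolding abs_mult by (intro mult_mono; simp)+
    then show ?thesis unfolding D_def by linarith
  qed
  show "wave A x \<le> wave A y"
    using x(2) by (rule DERIV_nonneg_imp_nondecreasing) (use D bound in blast)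
  \<comment> \<open>The upper bound on the increment is the monotonicity of
    \<open>t - wave A t\<close>, whose derivative is \<open>1 - D t\<close>.\<close>
  have "x - wave A x \<le> y - wave A y"
    using x(2)
  proof (rule DERIV_nonneg_imp_nondecreasing)
    fix t assume "x \<le> t" "t \<le> y"
    then have "((\<lambda>t. t - wave A t) has_real_derivative 1 - D t) (at t)"
      using D by (auto intro!: derivative_eq_intros)
    then show "\<exists>d. ((\<lambda>t. t - wave A t) has_real_derivative d) (at t) \<and> 0 \<le> d"
      using bound[of t] by force
  qed
  then show "wave A y - wave A x \<le> y - x" by simp
qed

definition wave_bit :: "real \<Rightarrow> nat \<Rightarrow> int" where
  "wave_bit A i = \<lfloor>wave A (real (Suc i))\<rfloor> - \<lfloor>wave A (real i)\<rfloor>"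

lemma sum_wave_bit: "(\<Sum>i<n. wave_bit A i) = \<lfloor>wave A (real n)\<rfloor>"
  unfolding wave_bit_def sum_lessThan_telescope[of "\<lambda>i. \<lfloor>wave A (real i)\<rfloor>"]
  by (simp add: wave_def)

text \<open>If a real number grows by at least 0 and at most 1, its floor grows by 0 or 1. The index
  0 is separate because the derivative bound needs a positive argument; there
  \<open>wave A 1 = 1/2\<close> has floor 0.\<close>

lemma wave_bit_cases:
  assumes "0 \<le> A" "A \<le> 1 / 4"
  shows "wave_bit A i = 0 \<or> wave_bit A i = 1"
proof (cases "i = 0")
  case True
  then show ?thesis by (simp add: wave_bit_def wave_def)
next
  case False
  then have "wave A i \<le> wave A (Suc i)" "wave A (Suc i) - wave A i \<le> 1"
    using wave_increment[OF assms, of i "Suc i"] by auto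
  then show ?thesis unfolding wave_bit_def by linarith
qed

section \<open>Sequences composed of marked blocks\<close>

lemma sum_blocks:
  fixes a :: "nat \<Rightarrow> 'a::comm_monoid_add"
  shows "(\<Sum>j<n * b. a j) = (\<Sum>i<n. \<Sum>j<b. a (i * b + j))"
proof (induction n)
  case (Suc n)
  have "(\<Sum>j<Suc n * b. a j) = (\<Sum>j<n * b. a j) + (\<Sum>j=n*b..<n*b + b. a j)"
    using sum.atLeastLessThan_concat[of 0 "n * b" "n * b + b" a]
    by (simp add: lessThan_atLeast0 add.commute)
  also have "(\<Sum>j=n*b..<n*b + b. a j) = (\<Sum>j<b. a (n * b + j))"
    using sum.shift_bounds_nat_ivl[of a 0 "n * b" b] by (simp add: lessThan_atLeast0 add.commute)
  finally show ?case using Suc.IH by simp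
qed simp

text \<open>The constant \<open>q\<close> per block only moves the centre of the averages. The
  markers contribute the wave in the variable \<open>n / b\<close>, so the amplitude drops from
  \<open>A\<close> to \<open>A / b\<close>.\<close>

lemma oscillation_wave_blocks:
  fixes a :: "nat \<Rightarrow> real" and q :: real
  assumes A: "0 \<le> A" "A \<le> 1 / 4" and b: "0 < b" and q: "0 \<le> q"
    and a: "\<And>j. 0 \<le> a j" "\<And>j. a j \<le> 1"
    and blocks: "\<And>i. (\<Sum>j<b. a (i * b + j)) = q + wave_bit A i"
  shows "oscillation (average a) = ereal (2 * A / b)"
proof -
  \<comment> \<open>Chosen so that \<open>n * u n = q * x + wave A x\<close> for
    \<open>x = n / b\<close>; the phase \<open>ln b\<close> comes from
    \<open>ln (n / b)\<close>.\<close>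
  define u where "u n = (q + 1 / 2) / b + A / b * sin (ln (real n) - ln (real b))" for n
  have bound: "\<bar>average a n - u n\<bar> \<le> (q + 2 + b) / n" if n: "b \<le> n" for n
  proof -
    define k where "k = n div b"
    have k: "k * b \<le> n" "n < k * b + b" "0 < k"
      using b n div_mult_mod_eq[of n b] mod_less_divisor[OF b, of n]
      unfolding k_def by (linarith, linarith, simp add: div_greater_zero_iff)
    have k_real: "real k * real b \<le> real n" "real n < real k * real b + real b"
      using k(1,2) by (simp_all only: of_nat_le_iff of_nat_less_iff flip: of_nat_mult of_nat_add)
    let ?x = "real n / real b"
    have x: "real k \<le> ?x" "?x \<le> real k + 1"
      using k_real b by (simp_all add: field_simps)
    have "(\<Sum>j<k * b. a j) = q * k + \<lfloor>wave A (real k)\<rfloor>"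
      unfolding sum_blocks blocks sum.distrib of_int_sum[symmetric] sum_wave_bit by simp
    moreover have "(\<Sum>j<n. a j) = (\<Sum>j<k * b. a j) + (\<Sum>j=k*b..<n. a j)"
      using sum.atLeastLessThan_concat[OF zero_le k(1), of a] by (simp add: lessThan_atLeast0)
    moreover have "0 \<le> (\<Sum>j=k*b..<n. a j)" using a by (intro sum_nonneg) auto
    moreover have "(\<Sum>j=k*b..<n. a j) \<le> b"
    proof -
      have "(\<Sum>j=k*b..<n. a j) \<le> (\<Sum>j=k*b..<n. 1)" using a by (intro sum_mono) auto
      also have "\<dots> \<le> b" using k(2) by simp
      finally show ?thesis .
    qed
    moreover have "n * u n = q * ?x + wave A ?x"
      using b n by (simp add: u_def wave_def ln_div field_simps)
    moreover have "wave A k \<le> wave A ?x" "wave A ?x - wave A k \<le> 1"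
      using wave_increment[OF A _ x(1)] k(3) x by auto
    moreover have "0 \<le> q * ?x - q * k" "q * ?x - q * k \<le> q"
      using mult_left_mono[OF x(1) q] mult_left_mono[OF x(2) q] by (simp_all add: algebra_simps)
    \<comment> \<open>The error consists of at most \<open>q\<close> from replacing \<open>k\<close>
      by \<open>n / b\<close> in the linear term, 1 from the same replacement in the wave, 1 from
      the floor and \<open>b\<close> from the incomplete last block.\<close>
    ultimately have *: "\<bar>(\<Sum>j<n. a j) - n * u n\<bar> \<le> q + 2 + b"
      by linarith
    have "average a n - u n = ((\<Sum>j<n. a j) - n * u n) / n"
      using b n by (simp add: average_def field_simps)
    then show ?thesis using * by (simp add: divide_right_mono)
  qed
  have "(\<lambda>n. average a n - u n) \<longlonglongrightarrow> 0"
  proof (rule Lim_null_comparison)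
    show "eventually (\<lambda>n. norm (average a n - u n) \<le> (q + 2 + b) / n) sequentially"
      using eventually_ge_at_top[of b] by eventually_elim (use bound in auto)
  qed (rule lim_const_over_n)
  then have "oscillation (average a) = oscillation u"
    by (rule oscillation_cong_tendsto)
  also have "\<dots> = ereal (2 * (A / b))"
    unfolding u_def using A by (intro oscillation_sin_ln) simp
  finally show ?thesis by simp
qed


section \<open>The level sets of the oscillation\<close>

lemma exists_popular_value:
  fixes g :: "'a \<Rightarrow> nat"
  assumes "finite S" "S \<noteq> {}" "\<And>x. x \<in> S \<Longrightarrow> g x \<le> K"
  obtains q where "real (card S) / real (K + 1) \<le> card {x \<in> S. g x = q}" "{x \<in> S. g x = q} \<noteq> {}"
proof -
  have "\<exists>q\<in>{..K}. real (card S) / real (K + 1) \<le> card {x \<in> S. g x = q}"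
  proof (rule ccontr)
    assume "\<not> ?thesis"
    then have less: "real (card {x \<in> S. g x = q}) < real (card S) / real (K + 1)" if "q \<in> {..K}" for q
      using that by (meson not_le)
    have "card S = card (\<Union>q\<in>{..K}. {x \<in> S. g x = q})"
      using assms(3) by (intro arg_cong[where f=card]) auto
    also have "\<dots> = (\<Sum>q\<in>{..K}. card {x \<in> S. g x = q})"
      using assms(1) by (intro card_UN_disjoint) auto
    finally have "real (card S) = (\<Sum>q\<in>{..K}. real (card {x \<in> S. g x = q}))" by simp
    also have "\<dots> < (\<Sum>q\<in>{..K}. real (card S) / real (K + 1))"
      using less by (intro sum_strict_mono) auto
    also have "\<dots> = real (card S)" by (simp add: field_simps)
    finally show False by simp
  qed
  then obtain q where q: "real (card S) / real (K + 1) \<le> card {x \<in> S. g x = q}" by blast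
  moreover have "0 < card S" using assms by (simp add: card_gt_0_iff)
  ultimately have "0 < card {x \<in> S. g x = q}"
    by (metis divide_pos_pos of_nat_0_less_iff less_le_trans add_gr_0 less_numeral_extra(1))
  then show ?thesis using that[OF q] by (simp only: card_gt_0_iff) blast
qed

text \<open>If \<open>i < k\<close>, then \<open>t\<close> is at least \<open>2 * s > 1/2\<close>, a
  contradiction; the other case is symmetric.\<close>

lemma dyadic_quotients_eq:
  fixes s t :: real
  assumes "s \<in> {1/4<..<1/2}" "t \<in> {1/4<..<1/2}" "s / 2 ^ i = t / 2 ^ k"
  shows "s = t"
proof -
  have *: "i \<ge> k" if "s / 2 ^ i = t / 2 ^ k" "s \<in> {1/4<..<1/2}" "t \<in> {1/4<..<1/2}" for s t :: real and i k
  proof (rule ccontr)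
    assume "\<not> i \<ge> k"
    then obtain d where k: "k = i + Suc d" using less_imp_Suc_add not_le by (metis add_Suc_right)
    then have "t = s * 2 * 2 ^ d" using that(1) by (simp add: power_add field_simps)
    moreover have "s * 2 * 1 \<le> s * 2 * 2 ^ d" using that(2) by (intro mult_left_mono) auto
    ultimately show False using that by simp
  qed
  have "i = k" using *[OF assms(3,1,2)] *[OF assms(3)[symmetric] assms(2,1)] by simp
  then show ?thesis using assms(3) by simp
qed

text \<open>Supplies the block length \<open>2 ^ k\<close>: the logarithmic losses per block, a
  constant and \<open>ln (2 ^ k)\<close>, are absorbed by an arbitrarily small rate
  \<open>c\<close>.\<close>

lemma log_deficit_small:
  fixes c M :: real
  assumes "0 < c"
  obtains k where "M + ln (2 ^ k) \<le> c * 2 ^ k"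
proof -
  have "(\<lambda>n. M / real n + ln (real n) / real n) \<longlonglongrightarrow> 0 + 0"
    by (intro tendsto_add lim_const_over_n lim_ln_over_n)
  then have "eventually (\<lambda>n. M / real n + ln (real n) / real n < c) sequentially"
    using assms by (intro order_tendstoD(2)[of _ 0]) auto
  then obtain n0 where n0: "\<And>n. n \<ge> n0 \<Longrightarrow> M / real n + ln (real n) / real n < c"
    by (auto simp: eventually_sequentially)
  \<comment> \<open>The exponent \<open>n0\<close> itself works, since \<open>2 ^ n0\<close> is
    already past the threshold \<open>n0\<close>.\<close>
  have "n0 \<le> 2 ^ n0" by (rule less_imp_le[OF less_exp])
  from n0[OF this] have "(M + ln (2 ^ n0)) / 2 ^ n0 < c" by (simp add: add_divide_distrib)
  then have "M + ln (2 ^ n0) \<le> c * 2 ^ n0" by (simp add: pos_divide_less_eq)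
  then show ?thesis by (rule that)
qed

context separated_ifs
begin

section \<open>The observable and its level sets\<close>

definition obs :: "real ^ 'd \<Rightarrow> real" where
  "obs x = of_bool (symb x = 1)"

definition osc :: "real ^ 'd \<Rightarrow> ereal" where
  "osc x = oscillation (average (\<lambda>j. of_bool (itin x j = 1)))"

definition level :: "real \<Rightarrow> (real ^ 'd) set" where
  "level t = {x \<in> X. \<exists>k::nat. osc x = ereal (t / 2 ^ k)}"

lemma continuous_obs: "continuous_on X obs"
proof -
  obtain \<delta> where \<delta>: "0 < \<delta>" "\<And>x y. x \<in> X \<Longrightarrow> y \<in> X \<Longrightarrow> dist x y < \<delta> \<Longrightarrow> symb x = symb y"
    using symb_eq_if_close by blast
  show ?thesis
    unfolding continuous_on_iff
  proof (intro ballI allI impI)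
    fix x and e :: real assume "x \<in> X" "0 < e"
    then have "dist (obs y) (obs x) < e" if "y \<in> X" "dist y x < \<delta>" for y
      using \<delta>(2)[OF that(1) _ that(2)] by (simp add: obs_def)
    then show "\<exists>d>0. \<forall>y\<in>X. dist y x < d \<longrightarrow> dist (obs y) (obs x) < e"
      using \<delta>(1) by blast
  qed
qed

lemma osc_f: "osc (f x) = osc x"
  unfolding osc_def itin_f by (rule oscillation_average_shift[where B=1]) auto

lemma level_subset: "level t \<subseteq> X"
  by (auto simp: level_def)

lemma f_level: "f ` level t \<subseteq> level t"
  by (auto simp: level_def osc_f f_in_X)

lemma T_level:
  assumes "i \<in> {1..m}" "x \<in> level t"
  shows "T i x \<in> level t"
  using assms osc_f[of "T i x"] by (simp add: level_def f_T T_in_X)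

lemma level_irregular:
  assumes "0 < t"
  shows "level t \<subseteq> irregular_set X f obs"
proof
  fix x assume "x \<in> level t"
  then obtain k where x: "x \<in> X" "osc x = ereal (t / 2 ^ k)" by (auto simp: level_def)
  then have "\<not> convergent (average (\<lambda>j. of_bool (itin x j = 1)))"
    using assms unfolding osc_def by (intro not_convergent_if_oscillation_pos[of _ "t / 2 ^ k"]) auto
  then show "x \<in> irregular_set X f obs"
    using x(1) by (simp add: irregular_set_def average_def[abs_def] obs_def itin_def)
qed

lemma level_disjoint:
  assumes "s \<in> {1/4<..<1/2}" "t \<in> {1/4<..<1/2}" "x \<in> level s" "x \<in> level t"
  shows "s = t"
proof -
  obtain i k where "osc x = ereal (s / 2 ^ i)" "osc x = ereal (t / 2 ^ k)"
    using assms(3,4) unfolding level_def by blast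
  then have "s / 2 ^ i = t / 2 ^ k" by simp
  with assms(1,2) show ?thesis by (rule dyadic_quotients_eq)
qed

lemma level_borel: "level t \<in> sets (restrict_space borel X)"
proof -
  have X: "X \<in> sets borel" using compact_X by (intro borel_compact)
  have m1: "1 \<in> {1..m}" using two_le_m by simp
  define A where "A j = {x \<in> X. itin x j = 1}" for j
  have [measurable]: "A j \<in> sets borel" for j
    unfolding A_def using m1 by (intro borel_compact compact_itin_eq)
  \<comment> \<open>A Borel function on the whole space that agrees with \<open>osc\<close> on
    \<open>X\<close>; off \<open>X\<close> the values of \<open>symb\<close> are unspecified, so
    \<open>osc\<close> itself cannot be shown measurable there.\<close>
  define h where "h x = oscillation (average (\<lambda>j. indicator (A j) x))" for x
  have [measurable]: "h \<in> borel_measurable borel"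
    unfolding h_def oscillation_def average_def by measurable
  have "h x = osc x" if "x \<in> X" for x
  proof -
    have "(\<lambda>j. indicator (A j) x :: real) = (\<lambda>j. of_bool (itin x j = 1))"
      using that by (auto simp: A_def indicator_def)
    then show ?thesis by (simp add: h_def osc_def)
  qed
  then have "level t = X \<inter> (\<Union>k::nat. {x \<in> space borel. h x = ereal (t / 2 ^ k)})"
    by (auto simp: level_def)
  also have "\<dots> \<in> sets borel"
    using X by (intro sets.Int sets.countable_UN) auto
  finally show ?thesis
    using X by (simp add: sets_restrict_space_iff level_subset)
qed

section \<open>Points of a level set with freely chosen words\<close>

lemma balanced_words:
  obtains W q where "W \<subseteq> words K" "W \<noteq> {}" "real m ^ K / (K + 1) \<le> card W"
    "\<And>w. w \<in> W \<Longrightarrow> (\<Sum>j<K. of_bool (w ! j = 1)) = real q"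
proof -
  let ?g = "\<lambda>w. \<Sum>j<K. of_bool (w ! j = 1) :: nat"
  have g_le: "?g w \<le> K" for w
    using sum_bounded_above[of "{..<K}" "\<lambda>j. of_bool (w ! j = 1) :: nat" 1] by simp
  have "words K \<noteq> {}" using card_words[of K] two_le_m by force
  then obtain q where q: "real (card (words K)) / real (K + 1) \<le> card {w \<in> words K. ?g w = q}"
      "{w \<in> words K. ?g w = q} \<noteq> {}"
    by (rule exists_popular_value[OF finite_words _ g_le])
  show ?thesis
  proof (rule that[of "{w \<in> words K. ?g w = q}" q])
    show "real m ^ K / (K + 1) \<le> card {w \<in> words K. ?g w = q}"
      using q(1) by (simp add: card_words add.commute)
    fix w assume "w \<in> {w \<in> words K. ?g w = q}"
    then have "real (?g w) = real q" by simp
    then show "(\<Sum>j<K. of_bool (w ! j = 1)) = real q" by simp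
  qed (use q(2) in auto)
qed

text \<open>Every block has \<open>q\<close> ones from its word, whichever word is chosen, plus its
  marker. With \<open>A = t / 2\<close> and \<open>b = 2 ^ k\<close> the oscillation is
  \<open>2 * A / b = t / 2 ^ k\<close>.\<close>

lemma marked_concatenation_in_level:
  assumes t: "0 \<le> t" "t \<le> 1/2" and K: "Suc K = 2 ^ k" and W: "W \<subseteq> words K"
    and q: "\<And>w. w \<in> W \<Longrightarrow> (\<Sum>j<K. of_bool (w ! j = 1)) = real q"
    and v: "\<And>i. v i \<in> W"
  shows "\<exists>x\<in>level t. x \<in> X \<and> (\<forall>i. v i = map (\<lambda>j. itin x (i * Suc K + j)) [0..<K])"
proof -
  define b where "b = Suc K"
  have wordD: "length (v i) = K" "set (v i) \<subseteq> {1..m}" for i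
    using v[of i] W by (auto simp: words_def)
  \<comment> \<open>Block \<open>i\<close> holds the word \<open>v i\<close> at offsets below
    \<open>K\<close> and the marker at offset \<open>K\<close>. The symbol 2, available as
    \<open>m\<close> is at least 2, stands for a marker bit 0.\<close>
  define c where "c n = (if n mod b < K then v (n div b) ! (n mod b)
      else if wave_bit (t / 2) (n div b) = 1 then 1 else 2)" for n
  have "c n \<in> {1..m}" for n
    unfolding c_def using wordD two_le_m nth_mem by (auto split: if_splits) fastforce+
  then obtain x where x: "x \<in> X" "itin x = c" using itin_surj[of c] by blast
  have divmod: "(i * b + j) div b = i \<and> (i * b + j) mod b = j" if "j < b" for i j
    using that by simp
  have c_word: "c (i * b + j) = v i ! j" if "j < K" for i j
    using that divmod[of j i] by (simp add: c_def b_def)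
  have c_mark: "c (i * b + K) = (if wave_bit (t / 2) i = 1 then 1 else 2)" for i
    using divmod[of K i] by (simp add: c_def b_def)
  have A: "0 \<le> t / 2" "t / 2 \<le> 1/4" using t by auto
  have "(\<Sum>j<b. of_bool (c (i * b + j) = 1)) = real q + wave_bit (t / 2) i" for i
  proof -
    have "(\<Sum>j<b. of_bool (c (i * b + j) = 1)) =
        (\<Sum>j<K. of_bool (c (i * b + j) = 1)) + (of_bool (c (i * b + K) = 1) :: real)"
      unfolding b_def by (rule sum.lessThan_Suc)
    also have "(\<Sum>j<K. of_bool (c (i * b + j) = 1)) = real q"
      unfolding q[OF v[of i], symmetric] by (rule sum.cong) (simp_all add: c_word)
    also have "of_bool (c (i * b + K) = 1) = real_of_int (wave_bit (t / 2) i)"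
      using wave_bit_cases[OF A, of i] by (auto simp: c_mark)
    finally show ?thesis .
  qed
  then have "osc x = ereal (2 * (t / 2) / b)"
    unfolding osc_def x(2) by (intro oscillation_wave_blocks[where q=q] A) (auto simp: b_def)
  also have "2 * (t / 2) / real b = t / 2 ^ k"
    using K by (simp add: b_def flip: of_nat_power)
  finally have "x \<in> level t" using x(1) by (auto simp: level_def)
  moreover have "v i = map (\<lambda>j. itin x (i * b + j)) [0..<K]" for i
    unfolding x(2) by (rule nth_equalityI) (simp_all add: wordD c_word)
  ultimately show ?thesis using x(1) unfolding b_def by blast
qed

text \<open>The degenerate case \<open>K = 0\<close>, \<open>k = 0\<close>: the words are empty and
  the itinerary consists of markers alone.\<close>

lemma level_nonempty:
  assumes "0 \<le> t" "t \<le> 1/2"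
  shows "level t \<noteq> {}"
proof -
  have "\<exists>x\<in>level t. x \<in> X \<and> (\<forall>i. [] = map (\<lambda>j. itin x (i * Suc 0 + j)) [0..<0])"
    by (rule marked_concatenation_in_level[OF assms, of 0 0 "{[]}" 0]) (auto simp: words_def)
  then show ?thesis by blast
qed

lemma level_entropy:
  assumes t: "0 \<le> t" "t \<le> 1/2"
  shows "subset_entropy X f (level t) = ereal (ln m)"
proof -
  obtain \<delta> where \<delta>: "0 < \<delta>" "\<And>x y. x \<in> X \<Longrightarrow> y \<in> X \<Longrightarrow> dist x y < \<delta> \<Longrightarrow> symb x = symb y"
    using symb_eq_if_close by blast
  show ?thesis
  proof (rule subset_entropy_eq_log[OF level_subset \<delta>(1)])
    fix \<U> \<alpha> assume \<U>: "open_cover X \<U>" "cover_diam \<U> < \<delta>" and \<alpha>: "\<alpha> < ln (real m)"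
    \<comment> \<open>Per block of length \<open>2 ^ k\<close>, the marker position loses
      \<open>ln m\<close> and the restriction to one count of ones loses at most
      \<open>ln (2 ^ k)\<close>; both must fit into the gap \<open>ln m - \<alpha>\<close>.\<close>
    obtain k where k: "ln (real m) + ln (2 ^ k) \<le> (ln m - \<alpha>) * 2 ^ k"
      using log_deficit_small[of "ln m - \<alpha>" "ln m"] \<alpha> by auto
    obtain K where K: "Suc K = 2 ^ k" by (metis Suc_pred' zero_less_numeral zero_less_power)
    then have K_real: "real K + 1 = 2 ^ k"
      by (metis of_nat_Suc of_nat_numeral of_nat_power add.commute)
    obtain W q where W: "W \<subseteq> words K" "W \<noteq> {}" "real m ^ K / (K + 1) \<le> card W"
        "\<And>w. w \<in> W \<Longrightarrow> (\<Sum>j<K. of_bool (w ! j = 1)) = real q"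
      using balanced_words by blast
    have pos: "0 < real m" using two_le_m by simp
    have "\<alpha> * 2 ^ k \<le> (2 ^ k - 1) * ln m - ln (2 ^ k)"
      using k by (simp add: algebra_simps)
    then have "\<alpha> * Suc K \<le> K * ln m - ln (K + 1)"
      unfolding K_real[symmetric] by (simp add: add.commute)
    also have "K * ln m - ln (K + 1) = ln (real m ^ K / (K + 1))"
      using pos by (simp add: ln_div ln_realpow)
    also have "\<dots> \<le> ln (card W)"
      using W(3) pos by (intro ln_mono) auto
    finally have "\<alpha> * Suc K \<le> ln (card W)" .
    then show "cover_measure X f \<U> (level t) \<alpha> \<noteq> 0"
      using finite_subset[OF W(1) finite_words] W(2)
      by (intro cover_measure_pos[OF \<delta>(2) \<U>, where W=W and K=K and b="Suc K"]
          marked_concatenation_in_level[OF t K W(1,4)]) auto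
  qed
qed

lemma level_dense: "0 \<le> t \<Longrightarrow> t \<le> 1/2 \<Longrightarrow> X \<subseteq> closure (level t)"
  using level_nonempty level_subset T_level by (rule dense_if_T_invariant)

end

theorem corollary1p3:
  fixes T :: "nat \<Rightarrow> real ^ 'd \<Rightarrow> real ^ 'd" and m :: nat and X :: "(real ^ 'd) set"
    and f :: "real ^ 'd \<Rightarrow> real ^ 'd"
  assumes "2 \<le> m"
    and "iterated_function_system m T"
    and "is_attractor m T X"
    and "strong_separation m T X"
    and "f = ifs_map m T X"
  shows "\<exists>\<N> :: (real ^ 'd) set set.
           uncountable \<N> \<and>
           (\<forall>N\<in>\<N>. N \<in> sets (restrict_space borel X)) \<and>
           (\<exists>\<phi> :: real ^ 'd \<Rightarrow> real. continuous_on X \<phi> \<and> (\<forall>N\<in>\<N>. N \<subseteq> irregular_set X f \<phi>)) \<and>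
           (\<forall>N\<in>\<N>. X \<subseteq> closure N \<and> f ` N \<subseteq> N) \<and>
           (\<forall>N\<in>\<N>. \<forall>N'\<in>\<N>. N \<noteq> N' \<longrightarrow> N \<inter> N' = {}) \<and>
           (\<forall>N\<in>\<N>. subset_entropy X f N = topological_entropy X f)"
proof -
  interpret ifs: separated_ifs m T X
    using assms(1-4) by unfold_locales
  have f: "f = ifs.f" by (simp add: assms(5) ifs.f_def)
  \<comment> \<open>The upper end keeps the wave amplitude \<open>t / 2\<close> below
    \<open>1/4\<close>; the ratio 2 of the ends makes different parameters give disjoint level
    sets.\<close>
  let ?I = "{1/4<..<1/2} :: real set"
  have "inj_on ifs.level ?I"
  proof (rule inj_onI)
    fix s t assume st: "s \<in> ?I" "t \<in> ?I" "ifs.level s = ifs.level t"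
    then obtain x where "x \<in> ifs.level s" using ifs.level_nonempty[of s] by auto
    then show "s = t" using st ifs.level_disjoint by simp
  qed
  then have unc: "uncountable (ifs.level ` ?I)"
    by (simp add: countable_image_inj_eq uncountable_open_interval)
  have props: "N \<in> sets (restrict_space borel X)" "N \<subseteq> irregular_set X f ifs.obs"
      "X \<subseteq> closure N" "f ` N \<subseteq> N" "subset_entropy X f N = topological_entropy X f"
    if N: "N \<in> ifs.level ` ?I" for N
  proof -
    obtain t where "t \<in> ?I" "N = ifs.level t" using N by blast
    then show "N \<in> sets (restrict_space borel X)" "N \<subseteq> irregular_set X f ifs.obs"
      "X \<subseteq> closure N" "f ` N \<subseteq> N" "subset_entropy X f N = topological_entropy X f"
      using ifs.level_borel ifs.level_irregular[of t] ifs.level_dense[of t] ifs.f_level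
        ifs.level_entropy[of t] ifs.topological_entropy_eq_log
      unfolding f by auto
  qed
  have disj: "N \<inter> N' = {}" if "N \<in> ifs.level ` ?I" "N' \<in> ifs.level ` ?I" "N \<noteq> N'" for N N'
    using that ifs.level_disjoint by blast
  show ?thesis
    by (intro exI[of _ "ifs.level ` ?I"] conjI exI[of _ ifs.obs] ballI impI
        unc props disj ifs.continuous_obs)
qed

end
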